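(* Let $\Delta\subseteq M_{\mathbb R}$ be a full-dimensional lattice polyhedron, $\Sigma=\mathcal N(\Delta)$, $X=\mathbb P(\Delta)$, and let $\Delta^+\subseteq\Delta^-$ be lattice polyhedra in $\mathrm{Pol}^+(\Sigma)$ such that $\Delta^-\setminus\Delta^+$ has exactly $n+1$ connected components $C_0,\dots,C_n$, $n\ge2$. Put $\nabla_i:=C_i\cup\Delta^+$ and assume $\nabla_i\in\mathrm{Pol}^+(\Sigma)$ for $i=0,\dots,n$. Consider the $T$-equivariant short exact sequence $$0\to\mathcal O_X(\Delta^+)^n\xrightarrow{A}\bigoplus_{i=0}^n\mathcal O_X(\nabla_i)\xrightarrow{(1\ 1\ \cdots\ 1)}\mathcal O_X(\Delta^-)\to0,$$ where $A(s_1,\dots,s_n)=(-s_1-\cdots-s_n,\,s_1,\dots,s_n)$. Then under the identification $\mathrm{Ext}^1\big(\mathcal O_X(\Delta^-),\mathcal O_X(\Delta^+)^n\big)_0=\widetilde H^0(\Delta^-\setminus\Delta^+,\mathbb C)^n$, this extension corresponds to the $n$-tuple $([C_1],\dots,[C_n])$.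
   Context: $M$ is a lattice of finite rank, $N$ its dual, $T=\mathrm{Spec}\,\mathbb C[M]$ with characters $\chi^m$. A polyhedron is a finite intersection of closed half-spaces in $M_{\mathbb R}$, always assumed to have at least one vertex; a lattice polyhedron has its vertices in $M$. For a full-dimensional lattice polyhedron $\Delta$, $\mathcal N(\Delta)$ is its inner normal fan (support $\mathrm{tail}(\Delta)^\vee$) and $\mathbb P(\Delta)$ the toric variety over $\mathbb C$ of this fan, with charts $U_\sigma=\mathrm{Spec}\,\mathbb C[\sigma^\vee\cap M]$. $\mathrm{Pol}^+(\Sigma)$ consists of the lattice polyhedra $\nabla$ with tail cone $|\Sigma|^\vee$ such that $v\mapsto\min\langle\nabla,v\rangle$ is linear on each cone of $\Sigma$ (also the empty set is included, but is not meant by "lattice polyhedra"). For such $\nabla$, $\mathcal O_X(\nabla)$ is the nef $T$-equivariant line bundle, a subsheaf of $j_*\mathcal O_T$ ($j:T\hookrightarrow X$), with $\Gamma(U_\sigma,\mathcal O_X(\nabla))=\bigoplus_{m\in(\nabla+\sigma^\vee)\cap M}\mathbb C\chi^m$; inclusions of polyhedra give inclusions of sheaves, and sections of $\mathcal O_X(\Delta^+)$ are regarded as sections of $\mathcal O_X(\nabla_i)$ and these as sections of $\mathcal O_X(\Delta^-)$ via these inclusions. $\mathcal O_X(\Delta^+-\Delta^-):=\mathcal O_X(\Delta^+)\otimes\mathcal O_X(\Delta^-)^{-1}$. Cohomology and Ext groups of these equivariant sheaves are $M$-graded; subscript $0$ is the degree $0\in M$ part. $\widetilde H^0(Z,\mathbb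 C)$ is the space of locally constant functions $Z\to\mathbb C$ modulo constants; $[C_i]$ is the class of the indicator function of the component $C_i$. Identification $\mathrm{Ext}^1(\mathcal O_X(\Delta^-),\mathcal O_X(\Delta^+)^n)_0=\widetilde H^0(\Delta^-\setminus\Delta^+,\mathbb C)^n$: put $\mathcal L=\mathcal O_X(\Delta^+-\Delta^-)$. (1) An extension is tensored with $\mathcal O_X(\Delta^-)^{-1}$ to give $0\to\mathcal L^n\to\mathcal E\to\mathcal O_X\to0$, and its class is the image of $1\in\Gamma(X,\mathcal O_X)$ under the connecting homomorphism to $H^1(X,\mathcal L)^n$. (2) $H^1(X,\mathcal L)$ is computed by Čech cohomology for the covering by $U_i=U_{\sigma_i}$, $\sigma_1,\dots,\sigma_k$ the maximal cones of $\Sigma$, with differential $(\delta s)_{ij}=s_j-s_i$. For $\tau\in\Sigma$ let $S(\tau)=\Delta^-\setminus(\Delta^++\tau^\vee)$; then $\mathcal L(U_\tau)_0=\mathbb C$ if $S(\tau)=\emptyset$ and $0$ otherwise, and each nonempty $S(\sigma_i)$ is connected. (3) The (known) isomorphism $\widetilde H^0(\Delta^-\setminus\Delta^+,\mathbb C)\to H^1(X,\mathcal L)_0$ (coming from the boundary map $H^0(\Delta^-\setminus\Delta^+)\to H^1(\Delta^-,\Delta^-\setminus\Delta^+)$) sends the class of a locally constant function $f$ to the class of the cocycle $(c_j-c_i)_{i<j}\in\prod_{i<j}\mathcal L(U_i\cap U_j)_0$, where $c_i$ is the value of $f$ on $S(\sigma_i)$ if $S(\sigma_i)\neq\emptyset$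 and $c_i\in\mathbb C$ is arbitrary otherwise. It is applied componentwise for $n$-tuples. *)

theory Defs
  imports
    "HOL-Analysis.Analysis"
    "HOL-Algebra.Ideal"
    "HOL-Library.Poly_Mapping"
    "HOL-Library.Function_Algebras"
    "HOL-Computational_Algebra.Fraction_Field"
begin

section \<open>Lattice, polyhedra, normal fans\<close>

text \<open>
  \<open>M = \<int>\<^sup>d\<close> is the type \<open>'d \<Rightarrow>\<^sub>0 int\<close> over a finite index type, and \<open>M\<^sub>\<real>\<close> and \<open>N\<^sub>\<real>\<close> are both
  \<open>'d rvec = real ^ 'd\<close>, paired by the standard inner product. The order on the index type carries no
  mathematical content: it only makes the library recognise the Laurent polynomial ring
  \<open>('d \<Rightarrow>\<^sub>0 int) \<Rightarrow>\<^sub>0 complex\<close> (\<open>= \<complex>[M]\<close>) as an integral domain.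
\<close>

type_synonym 'd rvec = "(real, 'd) vec"

definition real_pt :: "('d::finite \<Rightarrow>\<^sub>0 int) \<Rightarrow> 'd rvec" where
  "real_pt m = (\<chi> i. of_int (Poly_Mapping.lookup m i))"

definition lattice_polyhedron :: "'d::finite rvec set \<Rightarrow> bool" where
  "lattice_polyhedron P \<longleftrightarrow>
     polyhedron P \<and> (\<exists>v. v extreme_point_of P) \<and>
     (\<forall>v. v extreme_point_of P \<longrightarrow> v \<in> range real_pt)"

definition tail_cone :: "'d::finite rvec set \<Rightarrow> 'd rvec set" where
  "tail_cone P = {u. \<forall>x\<in>P. \<forall>t\<ge>0. x + t *\<^sub>R u \<in> P}"

definition dual_cone :: "'d::finite rvec set \<Rightarrow> 'd rvec set" where
  "dual_cone K = {v. \<forall>u\<in>K. 0 \<le> v \<bullet> u}"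

text \<open>The cone of all functionals \<open>v\<close> whose minimum over \<open>P\<close> is attained at every point of \<open>F\<close>.\<close>

definition inner_normal_cone :: "'d::finite rvec set \<Rightarrow> 'd rvec set \<Rightarrow> 'd rvec set" where
  "inner_normal_cone P F = {v. \<forall>u\<in>F. \<forall>w\<in>P. u \<bullet> v \<le> w \<bullet> v}"

definition normal_fan :: "'d::finite rvec set \<Rightarrow> 'd rvec set set" where
  "normal_fan P = {inner_normal_cone P F |F. F face_of P \<and> F \<noteq> {}}"

definition maximal_cones :: "'a set set \<Rightarrow> 'a set set" where
  "maximal_cones \<Sigma> = {\<sigma> \<in> \<Sigma>. \<forall>\<tau>\<in>\<Sigma>. \<sigma> \<subseteq> \<tau> \<longrightarrow> \<tau> = \<sigma>}"

definition is_min_on :: "'d::finite rvec set \<Rightarrow> 'd rvec \<Rightarrow> real \<Rightarrow> bool" where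
  "is_min_on P v r \<longleftrightarrow> (\<exists>u\<in>P. u \<bullet> v = r) \<and> (\<forall>w\<in>P. r \<le> w \<bullet> v)"

definition Pol_plus :: "'d::finite rvec set set \<Rightarrow> 'd rvec set set" where
  "Pol_plus \<Sigma> = insert {}
     {P. lattice_polyhedron P \<and> tail_cone P = dual_cone (\<Union>\<Sigma>) \<and>
         (\<forall>\<sigma>\<in>\<Sigma>. \<exists>l. linear l \<and> (\<forall>v\<in>\<sigma>. is_min_on P v (l v)))}"


section \<open>The toric variety of a fan\<close>

text \<open>
  All charts have the function field \<open>\<complex>(M)\<close>, and the variety is integral and separated. A point is
  therefore represented by its local ring inside \<open>\<complex>(M)\<close>; two points of different charts are glued
  iff they have the same local ring. Sections of the structure sheaf, and of subsheaves of
  \<open>j\<^sub>* \<O>\<^sub>T\<close>, over a nonempty open set are elements of \<open>\<complex>(M)\<close>, and restriction to a smaller nonempty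
  open set is the identity. Over the empty set the only section is 0.
\<close>

type_synonym 'd ratfun = "(('d \<Rightarrow>\<^sub>0 int) \<Rightarrow>\<^sub>0 complex) fract"

definition const_fun :: "complex \<Rightarrow> 'd::{finite,linorder} ratfun" where
  "const_fun c = Fract (Poly_Mapping.single 0 c) 1"

text \<open>\<open>laurent_span A = \<Oplus>\<^bsub>m \<in> A\<^esub> \<complex>\<chi>\<^sup>m\<close>; in particular \<open>laurent_span {m} = \<complex>\<chi>\<^sup>m\<close>.\<close>

definition laurent_span :: "('d \<Rightarrow>\<^sub>0 int) set \<Rightarrow> 'd::{finite,linorder} ratfun set" where
  "laurent_span A = {Fract q 1 |q. Poly_Mapping.keys q \<subseteq> A}"

definition chart_ring :: "'d rvec set \<Rightarrow> 'd::{finite,linorder} ratfun ring" where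
  "chart_ring \<sigma> =
     \<lparr>carrier = laurent_span {m. real_pt m \<in> dual_cone \<sigma>},
      mult = (*), one = 1, zero = 0, add = (+)\<rparr>"

definition Spec :: "'a ring \<Rightarrow> 'a set set" where
  "Spec R = {p. primeideal p R}"

definition zariski_open :: "'a ring \<Rightarrow> 'a set set \<Rightarrow> bool" where
  "zariski_open R W \<longleftrightarrow> (\<exists>E\<subseteq>carrier R. W = {p \<in> Spec R. \<not> E \<subseteq> p})"

text \<open>For a subring \<open>R\<close> of a field and an \<open>R\<close>-submodule \<open>N\<close> of that field: the localization \<open>N\<^sub>p\<close>.\<close>

definition localize :: "'a::field ring \<Rightarrow> 'a set \<Rightarrow> 'a set \<Rightarrow> 'a set" where
  "localize R p N = {g / b |g b. g \<in> N \<and> b \<in> carrier R \<and> b \<notin> p}"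

definition local_ring :: "'a::field ring \<Rightarrow> 'a set \<Rightarrow> 'a set" where
  "local_ring R p = localize R p (carrier R)"

definition chart :: "'d rvec set \<Rightarrow> 'd::{finite,linorder} ratfun set set" where
  "chart \<sigma> = local_ring (chart_ring \<sigma>) ` Spec (chart_ring \<sigma>)"

definition toric_variety ::
    "'d rvec set set \<Rightarrow> 'd::{finite,linorder} ratfun set topology" where
  "toric_variety \<Sigma> = topology (\<lambda>V. V \<subseteq> (\<Union>\<sigma>\<in>\<Sigma>. chart \<sigma>) \<and>
     (\<forall>\<sigma>\<in>\<Sigma>. zariski_open (chart_ring \<sigma>)
        {p \<in> Spec (chart_ring \<sigma>). local_ring (chart_ring \<sigma>) p \<in> V}))"

lemma zariski_open_Int:
  assumes "zariski_open R V" "zariski_open R W"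
  shows "zariski_open R (V \<inter> W)"
proof -
  obtain E F where E: "E \<subseteq> carrier R" "V = {p \<in> Spec R. \<not> E \<subseteq> p}"
    and F: "F \<subseteq> carrier R" "W = {p \<in> Spec R. \<not> F \<subseteq> p}"
    using assms unfolding zariski_open_def by blast
  let ?G = "{a \<otimes>\<^bsub>R\<^esub> b |a b. a \<in> E \<and> b \<in> F} \<inter> carrier R"
  have "V \<inter> W = {p \<in> Spec R. \<not> ?G \<subseteq> p}"
  proof (intro Set.set_eqI iffI)
    fix p assume p: "p \<in> V \<inter> W"
    then have prime: "primeideal p R" using E by (auto simp: Spec_def)
    interpret primeideal p R by (rule prime)
    obtain a b where "a \<in> E" "a \<notin> p" "b \<in> F" "b \<notin> p" using p E F by blast
    moreover from this have "a \<in> carrier R" "b \<in> carrier R" using E F by auto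
    moreover from calculation have "a \<otimes>\<^bsub>R\<^esub> b \<in> ?G" "a \<otimes>\<^bsub>R\<^esub> b \<notin> p"
      using I_prime m_closed by blast+
    ultimately show "p \<in> {p \<in> Spec R. \<not> ?G \<subseteq> p}"
      using prime unfolding Spec_def by blast
  next
    fix p assume p: "p \<in> {p \<in> Spec R. \<not> ?G \<subseteq> p}"
    then have prime: "primeideal p R" by (auto simp: Spec_def)
    interpret primeideal p R by (rule prime)
    obtain a b where ab: "a \<in> E" "b \<in> F" "a \<otimes>\<^bsub>R\<^esub> b \<notin> p" using p by blast
    then have "a \<notin> p" "b \<notin> p"
      using E F I_l_closed I_r_closed by blast+
    then show "p \<in> V \<inter> W" using ab p E F by blast
  qed
  then show ?thesis unfolding zariski_open_def by blast
qed

lemma zariski_open_UN: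
  assumes "\<And>i. i \<in> I \<Longrightarrow> zariski_open R (V i)"
  shows "zariski_open R (\<Union>i\<in>I. V i)"
proof -
  obtain E where E: "\<And>i. i \<in> I \<Longrightarrow> E i \<subseteq> carrier R \<and> V i = {p \<in> Spec R. \<not> E i \<subseteq> p}"
    using assms unfolding zariski_open_def by metis
  then have "(\<Union>i\<in>I. V i) = {p \<in> Spec R. \<not> (\<Union>i\<in>I. E i) \<subseteq> p}" by auto
  moreover have "(\<Union>i\<in>I. E i) \<subseteq> carrier R" using E by auto
  ultimately show ?thesis unfolding zariski_open_def by blast
qed

lemma openin_toric_variety:
  "openin (toric_variety \<Sigma>) V \<longleftrightarrow> V \<subseteq> (\<Union>\<sigma>\<in>\<Sigma>. chart \<sigma>) \<and>
     (\<forall>\<sigma>\<in>\<Sigma>. zariski_open (chart_ring \<sigma>)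
        {p \<in> Spec (chart_ring \<sigma>). local_ring (chart_ring \<sigma>) p \<in> V})"
proof -
  have Int: "{p \<in> A. f p \<in> V \<inter> W} = {p \<in> A. f p \<in> V} \<inter> {p \<in> A. f p \<in> W}"
    for A :: "'x set" and f :: "'x \<Rightarrow> 'y" and V W by auto
  have Un: "{p \<in> A. f p \<in> \<Union>\<V>} = (\<Union>V\<in>\<V>. {p \<in> A. f p \<in> V})"
    for A :: "'x set" and f :: "'x \<Rightarrow> 'y" and \<V> by auto
  have "istopology (\<lambda>V. V \<subseteq> (\<Union>\<sigma>\<in>\<Sigma>. chart \<sigma>) \<and>
     (\<forall>\<sigma>\<in>\<Sigma>. zariski_open (chart_ring \<sigma>)
        {p \<in> Spec (chart_ring \<sigma>). local_ring (chart_ring \<sigma>) p \<in> V}))"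
    unfolding istopology_def Int Un
    by (auto intro: zariski_open_Int zariski_open_UN)
  then show ?thesis
    unfolding toric_variety_def by (simp add: topology_inverse')
qed

lemma topspace_toric_variety: "topspace (toric_variety \<Sigma>) = (\<Union>\<sigma>\<in>\<Sigma>. chart \<sigma>)"
proof -
  have "zariski_open (chart_ring \<sigma>)
      {p \<in> Spec (chart_ring \<sigma>). local_ring (chart_ring \<sigma>) p \<in> (\<Union>\<sigma>\<in>\<Sigma>. chart \<sigma>)}"
    if "\<sigma> \<in> \<Sigma>" for \<sigma> :: "'a rvec set"
  proof -
    have "{p \<in> Spec (chart_ring \<sigma>). local_ring (chart_ring \<sigma>) p \<in> (\<Union>\<sigma>\<in>\<Sigma>. chart \<sigma>)}
        = Spec (chart_ring \<sigma>)"
      using that by (auto simp: chart_def)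
    also have "\<dots> = {p \<in> Spec (chart_ring \<sigma>). \<not> carrier (chart_ring \<sigma>) \<subseteq> p}"
    proof -
      have "\<not> carrier R \<subseteq> p" if "primeideal p R" for p and R :: "'a ratfun ring"
      proof -
        interpret primeideal p R by (rule that)
        show ?thesis using I_notcarr a_subset by blast
      qed
      then show ?thesis by (auto simp: Spec_def)
    qed
    finally show ?thesis unfolding zariski_open_def by blast
  qed
  then have "openin (toric_variety \<Sigma>) (\<Union>\<sigma>\<in>\<Sigma>. chart \<sigma>)"
    unfolding openin_toric_variety by blast
  then show ?thesis
    unfolding topspace_def using openin_toric_variety[of \<Sigma>] by blast
qed

text \<open>The points of \<open>chart \<sigma>\<close> are in bijection with the prime spectrum.\<close>

lemma inj_on_local_ring_chart:
  "inj_on (local_ring (chart_ring \<sigma>)) (Spec (chart_ring \<sigma>))"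
proof -
  let ?R = "chart_ring \<sigma>"
  have sub: "p \<subseteq> q"
    if p: "p \<in> Spec ?R" and q: "q \<in> Spec ?R" and eq: "local_ring ?R p = local_ring ?R q"
    for p q
  proof
    fix a assume a: "a \<in> p"
    interpret P: primeideal p ?R using p by (simp add: Spec_def)
    interpret Q: primeideal q ?R using q by (simp add: Spec_def)
    have aR: "a \<in> carrier ?R" using a P.a_subset by auto
    have one: "1 \<in> carrier ?R" "0 \<in> q" "1 \<notin> p"
      using P.one_closed additive_subgroup.zero_closed[OF Q.additive_subgroup_axioms]
        P.one_imp_carrier P.I_notcarr
      by (auto simp: chart_ring_def)
    show "a \<in> q"
    proof (rule ccontr)
      assume n: "a \<notin> q"
      then have a0: "a \<noteq> 0" using one by auto
      have "1 / a \<in> local_ring ?R q"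
        unfolding local_ring_def localize_def using one aR n by blast
      then have "1 / a \<in> local_ring ?R p" using eq by simp
      then obtain g b where gb: "1 / a = g / b" "g \<in> carrier ?R" "b \<in> carrier ?R" "b \<notin> p"
        unfolding local_ring_def localize_def by blast
      have "0 \<in> p" using additive_subgroup.zero_closed[OF P.additive_subgroup_axioms]
        by (simp add: chart_ring_def)
      then have "b \<noteq> 0" using gb(4) by auto
      then have "b = g * a" using gb(1) a0 by (simp add: field_simps)
      moreover have "g * a \<in> p"
        using P.I_l_closed[OF a gb(2)] by (simp add: chart_ring_def)
      ultimately show False using gb(4) by simp
    qed
  qed
  show ?thesis by (rule inj_onI) (metis sub subset_antisym)
qed


section \<open>Sheaves\<close>

definition struct_sheaf :: "'d::{finite,linorder} ratfun set set \<Rightarrow> 'd ratfun set" where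
  "struct_sheaf V = {f. (V = {} \<longrightarrow> f = 0) \<and> (\<forall>x\<in>V. f \<in> x)}"

text \<open>
  \<open>\<O>\<^sub>X(P)\<close>: on each chart it is the quasi-coherent sheaf of the module
  \<open>\<Oplus>\<^bsub>m \<in> (P + \<sigma>\<^sup>\<or>) \<inter> M\<^esub> \<complex>\<chi>\<^sup>m\<close>, given through its stalks, the localizations of this module.
\<close>

definition line_sheaf ::
    "'d rvec set set \<Rightarrow> 'd rvec set \<Rightarrow>
     'd::{finite,linorder} ratfun set set \<Rightarrow> 'd ratfun set" where
  "line_sheaf \<Sigma> P V = {f. (V = {} \<longrightarrow> f = 0) \<and>
     (\<forall>\<sigma>\<in>\<Sigma>. \<forall>p\<in>Spec (chart_ring \<sigma>). local_ring (chart_ring \<sigma>) p \<in> V \<longrightarrow>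
        f \<in> localize (chart_ring \<sigma>) p (laurent_span {m. real_pt m \<in> P + dual_cone \<sigma>}))}"

text \<open>For a subsheaf \<open>L\<close> of rational functions that is a line bundle, its inverse.\<close>

definition inv_sheaf ::
    "'d rvec set set \<Rightarrow> ('d::{finite,linorder} ratfun set set \<Rightarrow> 'd ratfun set) \<Rightarrow>
     'd ratfun set set \<Rightarrow> 'd ratfun set" where
  "inv_sheaf \<Sigma> L V = {f. (V = {} \<longrightarrow> f = 0) \<and>
     (\<forall>W. openin (toric_variety \<Sigma>) W \<longrightarrow> W \<subseteq> V \<longrightarrow> (\<forall>g\<in>L W. f * g \<in> struct_sheaf W))}"

text \<open>
  The tensor product of a sheaf \<open>F\<close> of \<open>\<complex>(M)\<close>-vectors with a line bundle \<open>L\<close> of rational functions,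
  as the sheaf locally generated by products; \<open>sc\<close> is the scalar multiplication. Demanding in
  addition \<open>W \<subseteq> V\<close> would make no difference for open \<open>V\<close>, as sections may be restricted.
\<close>

definition tensor_sheaf ::
    "'d rvec set set \<Rightarrow> ('d ratfun \<Rightarrow> 'a \<Rightarrow> 'a) \<Rightarrow>
     ('d::{finite,linorder} ratfun set set \<Rightarrow> 'a::ab_group_add set) \<Rightarrow>
     ('d ratfun set set \<Rightarrow> 'd ratfun set) \<Rightarrow> 'd ratfun set set \<Rightarrow> 'a set" where
  "tensor_sheaf \<Sigma> sc F L V = {f. (V = {} \<longrightarrow> f = 0) \<and>
     (\<forall>x\<in>V. \<exists>W. openin (toric_variety \<Sigma>) W \<and> x \<in> W \<and>
        (\<exists>N::nat. \<exists>a b. (\<forall>l<N. a l \<in> F W \<and> b l \<in> L W) \<and> f = (\<Sum>l<N. sc (b l) (a l))))}"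

definition vscale :: "'a::times \<Rightarrow> ('i \<Rightarrow> 'a) \<Rightarrow> 'i \<Rightarrow> 'a" where
  "vscale r s = (\<lambda>i. r * s i)"

definition direct_sum :: "'i set \<Rightarrow> ('i \<Rightarrow> 'x set \<Rightarrow> 'a::zero set) \<Rightarrow> 'x set \<Rightarrow> ('i \<Rightarrow> 'a) set" where
  "direct_sum I F V = {s. (\<forall>i\<in>I. s i \<in> F i V) \<and> (\<forall>i. i \<notin> I \<longrightarrow> s i = 0)}"

definition sheaf_hom ::
    "'d rvec set set \<Rightarrow>
     ('d::{finite,linorder} ratfun \<Rightarrow> 'a \<Rightarrow> 'a) \<Rightarrow> ('d ratfun \<Rightarrow> 'b \<Rightarrow> 'b) \<Rightarrow>
     ('d ratfun set set \<Rightarrow> 'a::ab_group_add set) \<Rightarrow> ('d ratfun set set \<Rightarrow> 'b::ab_group_add set) \<Rightarrow>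
     ('a \<Rightarrow> 'b) \<Rightarrow> bool" where
  "sheaf_hom \<Sigma> scF scG F G \<phi> \<longleftrightarrow>
     (\<forall>V. openin (toric_variety \<Sigma>) V \<longrightarrow>
        (\<forall>s\<in>F V. \<phi> s \<in> G V) \<and>
        (\<forall>s\<in>F V. \<forall>t\<in>F V. \<phi> (s + t) = \<phi> s + \<phi> t) \<and>
        (\<forall>r\<in>struct_sheaf V. \<forall>s\<in>F V. \<phi> (scF r s) = scG r (\<phi> s)))"

definition short_exact ::
    "'d rvec set set \<Rightarrow> ('d::{finite,linorder} ratfun set set \<Rightarrow> 'a::ab_group_add set) \<Rightarrow>
     ('a \<Rightarrow> 'b) \<Rightarrow> ('d ratfun set set \<Rightarrow> 'b::ab_group_add set) \<Rightarrow>
     ('b \<Rightarrow> 'c) \<Rightarrow> ('d ratfun set set \<Rightarrow> 'c::ab_group_add set) \<Rightarrow> bool" where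
  "short_exact \<Sigma> F \<alpha> E \<beta> G \<longleftrightarrow>
     (\<forall>V. openin (toric_variety \<Sigma>) V \<longrightarrow>
        (\<forall>s\<in>F V. \<alpha> s = 0 \<longrightarrow> s = 0) \<and>
        (\<forall>e\<in>E V. \<beta> e = 0 \<longleftrightarrow>
           (\<forall>x\<in>V. \<exists>W. openin (toric_variety \<Sigma>) W \<and> x \<in> W \<and> W \<subseteq> V \<and> (\<exists>s\<in>F W. \<alpha> s = e))) \<and>
        (\<forall>g\<in>G V. \<forall>x\<in>V. \<exists>W. openin (toric_variety \<Sigma>) W \<and> x \<in> W \<and> W \<subseteq> V \<and> (\<exists>e\<in>E W. \<beta> e = g)))"

text \<open>Sections of degree \<open>m\<close>; \<open>T\<close>-equivariance of a map is preservation of degrees.\<close>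

definition homogeneous :: "('d \<Rightarrow>\<^sub>0 int) \<Rightarrow> ('i \<Rightarrow> 'd::{finite,linorder} ratfun) set" where
  "homogeneous m = {s. \<forall>i. s i \<in> laurent_span {m}}"


section \<open>Cech cohomology\<close>

text \<open>
  For sheaves without explicit restriction maps as above, and a covering \<open>U 1, \<dots>, U k\<close> all of whose
  intersections are nonempty. Cochains are extended by 0 to the remaining indices.
\<close>

definition cech_diff :: "nat \<Rightarrow> (nat \<Rightarrow> 'a::ab_group_add) \<Rightarrow> nat \<Rightarrow> nat \<Rightarrow> 'a" where
  "cech_diff k s = (\<lambda>i j. if 1 \<le> i \<and> i < j \<and> j \<le> k then s j - s i else 0)"

definition cech_Z1 ::
    "nat \<Rightarrow> (nat \<Rightarrow> 'x set) \<Rightarrow> ('x set \<Rightarrow> 'a::ab_group_add set) \<Rightarrow> (nat \<Rightarrow> nat \<Rightarrow> 'a) set" where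
  "cech_Z1 k U F = {z.
     (\<forall>i j. if 1 \<le> i \<and> i < j \<and> j \<le> k then z i j \<in> F (U i \<inter> U j) else z i j = 0) \<and>
     (\<forall>i j l. 1 \<le> i \<and> i < j \<and> j < l \<and> l \<le> k \<longrightarrow> z j l - z i l + z i j = 0)}"

definition cech_rel ::
    "nat \<Rightarrow> (nat \<Rightarrow> 'x set) \<Rightarrow> ('x set \<Rightarrow> 'a::ab_group_add set) \<Rightarrow>
     ((nat \<Rightarrow> nat \<Rightarrow> 'a) \<times> (nat \<Rightarrow> nat \<Rightarrow> 'a)) set" where
  "cech_rel k U F = {(z, w). z \<in> cech_Z1 k U F \<and> w \<in> cech_Z1 k U F \<and>
     (\<exists>s. (\<forall>i\<in>{1..k}. s i \<in> F (U i)) \<and> w - z = cech_diff k s)}"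

definition cech_H1 ::
    "nat \<Rightarrow> (nat \<Rightarrow> 'x set) \<Rightarrow> ('x set \<Rightarrow> 'a::ab_group_add set) \<Rightarrow> (nat \<Rightarrow> nat \<Rightarrow> 'a) set set" where
  "cech_H1 k U F = cech_Z1 k U F // cech_rel k U F"

text \<open>The degree \<open>m\<close> part of \<open>H\<^sup>1\<close>, as a subset of \<open>H\<^sup>1\<close>: the classes of the cocycles of degree \<open>m\<close>.\<close>

definition cech_H1_deg ::
    "('d \<Rightarrow>\<^sub>0 int) \<Rightarrow> nat \<Rightarrow> (nat \<Rightarrow> 'x set) \<Rightarrow> ('x set \<Rightarrow> 'd::{finite,linorder} ratfun set) \<Rightarrow>
     (nat \<Rightarrow> nat \<Rightarrow> 'd ratfun) set set" where
  "cech_H1_deg m k U F =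
     {cech_rel k U F `` {z} |z. z \<in> cech_Z1 k U F \<and> (\<forall>i j. z i j \<in> laurent_span {m})}"

text \<open>
  The connecting homomorphism \<open>\<Gamma>(X, G) \<rightarrow> H\<^sup>1(X, F)\<close> of an exact sequence
  \<open>0 \<rightarrow> F \<rightarrow> E \<rightarrow> G \<rightarrow> 0\<close> with maps \<open>\<alpha>, \<beta>\<close>, at the global section \<open>g\<close>. The class is the set of all
  cocycles arising from some choice of local lifts \<open>e i\<close> of \<open>g\<close>.
\<close>

definition connecting ::
    "nat \<Rightarrow> (nat \<Rightarrow> 'x set) \<Rightarrow> ('x set \<Rightarrow> 'a::ab_group_add set) \<Rightarrow> ('a \<Rightarrow> 'b) \<Rightarrow>
     ('x set \<Rightarrow> 'b::ab_group_add set) \<Rightarrow> ('b \<Rightarrow> 'c) \<Rightarrow> 'c \<Rightarrow> (nat \<Rightarrow> nat \<Rightarrow> 'a) set" where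
  "connecting k U F \<alpha> E \<beta> g = {z \<in> cech_Z1 k U F. \<exists>e.
     (\<forall>i\<in>{1..k}. e i \<in> E (U i) \<and> \<beta> (e i) = g) \<and>
     (\<forall>i j. 1 \<le> i \<and> i < j \<and> j \<le> k \<longrightarrow> \<alpha> (z i j) = e j - e i)}"


section \<open>Extension classes and reduced cohomology of the difference\<close>

definition difference_sheaf ::
    "'d rvec set set \<Rightarrow> 'd rvec set \<Rightarrow> 'd rvec set \<Rightarrow>
     'd::{finite,linorder} ratfun set set \<Rightarrow> 'd ratfun set" where
  "difference_sheaf \<Sigma> \<Delta>p \<Delta>m =
     tensor_sheaf \<Sigma> (*) (line_sheaf \<Sigma> \<Delta>p) (inv_sheaf \<Sigma> (line_sheaf \<Sigma> \<Delta>m))"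

text \<open>
  The class in \<open>H\<^sup>1(X, L)\<^sup>n\<close>, \<open>L = \<O>\<^sub>X(\<Delta>\<^sup>+ - \<Delta>\<^sup>-)\<close>, of an extension \<open>E\<close> of \<open>\<O>\<^sub>X(\<Delta>\<^sup>-)\<close> by
  \<open>\<O>\<^sub>X(\<Delta>\<^sup>+)\<^sup>n\<close>. After tensoring with \<open>\<O>\<^sub>X(\<Delta>\<^sup>-)\<^sup>-\<^sup>1\<close> the maps \<open>\<alpha>, \<beta>\<close>, being linear over the function
  field, are given by the same formulas.
\<close>

definition ext_class ::
    "'d rvec set set \<Rightarrow> nat \<Rightarrow> (nat \<Rightarrow> 'd rvec set) \<Rightarrow> nat \<Rightarrow>
     'd rvec set \<Rightarrow> 'd rvec set \<Rightarrow>
     ((nat \<Rightarrow> 'd ratfun) \<Rightarrow> (nat \<Rightarrow> 'd ratfun)) \<Rightarrow>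
     ('d::{finite,linorder} ratfun set set \<Rightarrow> (nat \<Rightarrow> 'd ratfun) set) \<Rightarrow>
     ((nat \<Rightarrow> 'd ratfun) \<Rightarrow> 'd ratfun) \<Rightarrow> nat \<Rightarrow> (nat \<Rightarrow> nat \<Rightarrow> 'd ratfun) set" where
  "ext_class \<Sigma> k \<sigma> n \<Delta>p \<Delta>m \<alpha> E \<beta> =
     (\<lambda>a\<in>{1..n}. (\<lambda>z i j. z i j a) `
        connecting k (\<lambda>i. chart (\<sigma> i))
          (direct_sum {1..n} (\<lambda>_. difference_sheaf \<Sigma> \<Delta>p \<Delta>m)) \<alpha>
          (tensor_sheaf \<Sigma> vscale E (inv_sheaf \<Sigma> (line_sheaf \<Sigma> \<Delta>m))) \<beta> 1)"

definition loc_const :: "'t::topological_space set \<Rightarrow> ('t \<Rightarrow> complex) set" where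
  "loc_const Z = {f. locally (\<lambda>U. f constant_on U) Z}"

text \<open>Functions are only considered on \<open>Z\<close>; the relation also forgets their values elsewhere.\<close>

definition const_rel :: "'t::topological_space set \<Rightarrow> (('t \<Rightarrow> complex) \<times> ('t \<Rightarrow> complex)) set" where
  "const_rel Z = {(f, g). f \<in> loc_const Z \<and> g \<in> loc_const Z \<and> (\<exists>c. \<forall>z\<in>Z. g z = f z + c)}"

definition reduced_H0 :: "'t::topological_space set \<Rightarrow> ('t \<Rightarrow> complex) set set" where
  "reduced_H0 Z = loc_const Z // const_rel Z"

text \<open>
  The isomorphism from the reduced \<open>H\<^sup>0(\<Delta>\<^sup>- - \<Delta>\<^sup>+)\<close> to \<open>H\<^sup>1(X, L)\<^sub>0\<close>. The union is over all choices of
  a representative \<open>f\<close> and of constants \<open>c\<close>; they all give the same class.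
\<close>

definition H0_to_H1 ::
    "'d rvec set set \<Rightarrow> nat \<Rightarrow> (nat \<Rightarrow> 'd rvec set) \<Rightarrow>
     'd rvec set \<Rightarrow> 'd rvec set \<Rightarrow>
     ('d rvec \<Rightarrow> complex) set \<Rightarrow> (nat \<Rightarrow> nat \<Rightarrow> 'd::{finite,linorder} ratfun) set" where
  "H0_to_H1 \<Sigma> k \<sigma> \<Delta>p \<Delta>m \<xi> =
     (\<Union>f\<in>\<xi>. \<Union>c\<in>{c. \<forall>i\<in>{1..k}. \<forall>z\<in>\<Delta>m - (\<Delta>p + dual_cone (\<sigma> i)). f z = c i}.
        cech_rel k (\<lambda>i. chart (\<sigma> i)) (difference_sheaf \<Sigma> \<Delta>p \<Delta>m) ``
          {cech_diff k (\<lambda>i. const_fun (c i))})"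

definition ext_incl :: "nat \<Rightarrow> (nat \<Rightarrow> 'a::ab_group_add) \<Rightarrow> nat \<Rightarrow> 'a" where
  "ext_incl n s = (\<lambda>i. if i = 0 then - (\<Sum>j=1..n. s j) else if i \<le> n then s i else 0)"

definition ext_sum :: "nat \<Rightarrow> (nat \<Rightarrow> 'a::ab_group_add) \<Rightarrow> 'a" where
  "ext_sum n e = (\<Sum>i=0..n. e i)"

end

theory Submission
  imports Defs
begin

text \<open>
  For a cone \<open>\<sigma>\<close> of the fan, a polyhedron \<open>P\<close> in \<open>Pol\<^sup>+(\<Sigma>)\<close> has a lattice point \<open>m\<close> with \<open>P + \<sigma>\<^sup>\<or> = m + \<sigma>\<^sup>\<or>\<close>,
  so \<open>\<O>(P)\<close> is generated by \<open>\<chi>\<^sup>m\<close> on the chart of \<open>\<sigma>\<close>; at a common point of two charts both generators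
  differ by a unit because each exponent lies in the other translated cone. The set
  \<open>S(\<sigma>) = \<Delta>\<^sup>- - (\<Delta>\<^sup>+ + \<sigma>\<^sup>\<or>)\<close> is empty or star-shaped about the point \<open>m\<close> of \<open>\<Delta>\<^sup>-\<close>, hence it lies in a single
  component \<open>C\<^sub>i\<close>. On this chart \<open>\<O>(\<nabla>\<^sub>i) = \<O>(\<Delta>\<^sup>-)\<close> and \<open>\<O>(\<nabla>\<^sub>j) = \<O>(\<Delta>\<^sup>+)\<close> for all \<open>j \<noteq> i\<close>, which gives
  exactness. It also shows that the \<open>i\<close>-th unit vector lifts the section 1; the differences of these lifts
  form the cocycle attached to the indicator functions of the components.
\<close>


section \<open>Polyhedra and cones\<close>

text \<open>All sheaves are described by local equations, so twisting by the inverse of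
  O(\<Delta>^-) merely divides equations, and comparing two bundles on a chart means asking whether
  a difference of two vertices lies in a dual cone. If S(\<sigma>) is empty, it singles out no
  component. Any index whose \<nabla>_i contains the chosen vertex of \<Delta>^- is then accepted.
  This is harmless because O(\<Delta>^-) = O(\<Delta>^+) on such a chart: constants are sections of
  the difference sheaf there, and changing them alters a cocycle by a coboundary. The same equality
  holds on the overlap of two charts with different indices, which is why differences of indicator
  values are sections of the difference sheaf at all. Nonzero constants also need nonempty overlaps,
  since over the empty set the only section is 0; the full dimension of \<Delta> puts the generic
  point into every chart. Both sides of the final equation are sets of cocycles, so each is shown to
  be the whole class of one explicit cocycle, \<open>unit_cocycle\<close>.\<close>

lemma exists_affine_face:
  fixes P :: "'a::euclidean_space set"
  assumes "polyhedron P" "P \<noteq> {}"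
  shows "\<exists>F. F face_of P \<and> F \<noteq> {} \<and> affine F"
  using assms
\<comment> \<open>Descent on the dimension: a polyhedron that is not affine has a facet, and faces
  of a facet are faces of the polyhedron.\<close>
proof (induction "nat (aff_dim P)" arbitrary: P rule: less_induct)
  case less
  have conv: "convex P" "closed P"
    using less.prems by (auto intro: polyhedron_imp_convex polyhedron_imp_closed)
  show ?case
  proof (cases "rel_frontier P = {}")
    case True
    then have "affine P" by (simp add: rel_frontier_eq_empty)
    then show ?thesis using conv less.prems face_of_refl by blast
  next
    case False
    then obtain F where F: "F facet_of P" "F \<noteq> {}"
      using rel_frontier_of_polyhedron[OF less.prems(1)] by auto
    then have face: "F face_of P" and "aff_dim F < aff_dim P"
      by (auto simp: facet_of_def)
    \<comment> \<open>\<open>nat\<close> truncates negative dimensions, so strict decrease survives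
      it only because \<open>F\<close> is nonempty.\<close>
    moreover have "aff_dim F \<ge> 0" using F(2) aff_dim_negative_iff[of F] by linarith
    ultimately have "nat (aff_dim F) < nat (aff_dim P)" by simp
    moreover have "polyhedron F" using face less.prems(1) face_of_polyhedron_polyhedron by blast
    ultimately show ?thesis using less.hyps F(2) face face_of_trans by metis
  qed
qed

text \<open>A half-space containing a line has its normal orthogonal to the direction, so it
  contains every parallel line through one of its points.\<close>

lemma polyhedron_line_translate:
  fixes P :: "'a::euclidean_space set"
  assumes "polyhedron P" and line: "\<And>t. x + t *\<^sub>R d \<in> P" and v: "v \<in> P"
  shows "v + t *\<^sub>R d \<in> P"
proof -
  obtain F where F: "finite F" "P = \<Inter>F" "\<And>h. h \<in> F \<Longrightarrow> \<exists>a b. a \<noteq> 0 \<and> h = {x. a \<bullet> x \<le> b}"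
    using assms(1) unfolding polyhedron_def by blast
  have "v + t *\<^sub>R d \<in> h" if h: "h \<in> F" for h
  proof -
    obtain a b where ab: "h = {x. a \<bullet> x \<le> b}" using F(3)[OF h] by blast
    have ineq: "a \<bullet> x + s * (a \<bullet> d) \<le> b" for s
      using line[of s] F(2) h ab by (auto simp: inner_add_right)
    have "a \<bullet> d = 0"
    proof (rule ccontr)
      assume "a \<bullet> d \<noteq> 0"
      then show False using ineq[of "(b - a \<bullet> x + 1) / (a \<bullet> d)"] by simp
    qed
    then show ?thesis using v F(2) h ab by (auto simp: inner_add_right)
  qed
  then show ?thesis using F(2) by blast
qed

text \<open>An affine face of \<open>G\<close> with two points would give a line in
  \<open>P\<close>. The parallel line through \<open>v\<close> would also lie in \<open>P\<close>
  and make \<open>v\<close> an interior point of a segment. Hence the affine face is a single point,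
  which is a vertex.\<close>

lemma polyhedron_face_has_extreme_point:
  fixes P :: "'a::euclidean_space set"
  assumes P: "polyhedron P" and v: "v extreme_point_of P" and G: "G face_of P" "G \<noteq> {}"
  shows "\<exists>x\<in>G. x extreme_point_of P"
proof -
  have "polyhedron G" using P G(1) face_of_polyhedron_polyhedron by blast
  then obtain F where F: "F face_of G" "F \<noteq> {}" "affine F"
    using exists_affine_face G(2) by blast
  then have face: "F face_of P" using G(1) face_of_trans by blast
  obtain x where x: "x \<in> F" using F(2) by blast
  have "y = x" if y: "y \<in> F" for y
  proof (rule ccontr)
    assume ne: "y \<noteq> x"
    have "x + t *\<^sub>R (y - x) \<in> P" for t
    proof -
      have "(1 - t) *\<^sub>R x + t *\<^sub>R y \<in> F" using F(3) x y unfolding affine_alt by blast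
      then show ?thesis using face_of_imp_subset[OF face] by (auto simp: algebra_simps)
    qed
    then have "v + t *\<^sub>R (y - x) \<in> P" for t
      using polyhedron_line_translate P v extreme_point_of_def by metis
    from this[of 1] this[of "-1"] have "v + (y - x) \<in> P" "v - (y - x) \<in> P"
      by (simp_all add: algebra_simps)
    moreover have "v \<in> open_segment (v + (y - x)) (v - (y - x))"
    proof -
      have "v = midpoint (v + (y - x)) (v - (y - x))"
        by (simp add: midpoint_def algebra_simps flip: scaleR_add_left)
      moreover have "v + (y - x) \<noteq> v - (y - x)"
      proof
        assume "v + (y - x) = v - (y - x)"
        then have "2 *\<^sub>R (y - x) = 0" by (simp add: scaleR_2 algebra_simps)
        then show False using ne by simp
      qed
      ultimately show ?thesis by (metis midpoint_in_open_segment)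
    qed
    ultimately show False using v unfolding extreme_point_of_def by blast
  qed
  then have "F = {x}" using x by blast
  then show ?thesis
    using face F(1) face_of_imp_subset face_of_singleton by blast
qed

text \<open>
  The vertex is taken in the face on which an element \<open>v\<close> of the relative interior of \<open>\<sigma>\<close> is minimal:
  a linear form that is nonnegative on \<open>\<sigma>\<close> and vanishes at \<open>v\<close> vanishes on \<open>\<sigma>\<close>.
\<close>

lemma lattice_polyhedron_vertex_on_cone:
  fixes P \<sigma> :: "'d::finite rvec set"
  assumes P: "lattice_polyhedron P" and \<sigma>: "convex \<sigma>" "\<sigma> \<noteq> {}"
    and l: "linear l" and min: "\<And>v. v \<in> \<sigma> \<Longrightarrow> is_min_on P v (l v)"
  shows "\<exists>m. real_pt m \<in> P \<and> (\<forall>w\<in>P. w - real_pt m \<in> dual_cone \<sigma>)"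
proof -
  have poly: "polyhedron P" using P by (simp add: lattice_polyhedron_def)
  obtain v0 where v0: "v0 \<in> rel_interior \<sigma>" using rel_interior_eq_empty \<sigma> by blast
  then have v0\<sigma>: "v0 \<in> \<sigma>" using rel_interior_subset by blast
  let ?G = "P \<inter> {x. v0 \<bullet> x = l v0}"
  have "?G face_of P"
  proof (rule face_of_Int_supporting_hyperplane_ge)
    show "convex P" using poly polyhedron_imp_convex by blast
    show "v0 \<bullet> x \<ge> l v0" if "x \<in> P" for x
      using min[OF v0\<sigma>] that by (simp add: is_min_on_def inner_commute[of v0])
  qed
  moreover have "?G \<noteq> {}"
    using min[OF v0\<sigma>] by (auto simp: is_min_on_def inner_commute)
  ultimately obtain u where u: "u \<in> ?G" "u extreme_point_of P"
    using polyhedron_face_has_extreme_point poly P unfolding lattice_polyhedron_def by blast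
  have eq: "u \<bullet> v = l v" if v: "v \<in> \<sigma>" for v
  proof -
    have ge: "u \<bullet> w - l w \<ge> 0" if "w \<in> \<sigma>" for w
      using min[OF that] u(1) by (simp add: is_min_on_def)
    \<comment> \<open>The segment from \<open>v\<close> to \<open>v0\<close> can be prolonged beyond
      \<open>v0\<close> inside \<sigma>. The form vanishes at \<open>v0\<close>, so at the new point
      it has the opposite sign to its value at \<open>v\<close>; being nonnegative at both, it is 0
      at \<open>v\<close>.\<close>
    obtain e where e: "e > 1" "(1 - e) *\<^sub>R v + e *\<^sub>R v0 \<in> \<sigma>"
      using v0 v convex_rel_interior_iff[OF \<sigma>] by blast
    have "u \<bullet> ((1 - e) *\<^sub>R v + e *\<^sub>R v0) - l ((1 - e) *\<^sub>R v + e *\<^sub>R v0)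
        = (1 - e) * (u \<bullet> v - l v) + e * (u \<bullet> v0 - l v0)"
      using l by (simp add: linear_add linear_diff linear_scale inner_add_right algebra_simps)
    also have "\<dots> = - ((e - 1) * (u \<bullet> v - l v))"
      using u(1) by (simp add: inner_commute algebra_simps)
    finally have "(e - 1) * (u \<bullet> v - l v) \<le> 0" using ge[OF e(2)] by simp
    then have "u \<bullet> v - l v \<le> 0" using e(1) by (simp add: mult_le_0_iff)
    then show ?thesis using ge[OF v] by simp
  qed
  obtain m where m: "u = real_pt m" using P u(2) unfolding lattice_polyhedron_def by blast
  have "w - u \<in> dual_cone \<sigma>" if "w \<in> P" for w
    using min that eq by (auto simp: dual_cone_def is_min_on_def inner_diff_left)
  then show ?thesis using m u(1) by blast
qed

section \<open>Normal cones, their duals, and lattice points\<close>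

lemma convex_inner_normal_cone: "convex (inner_normal_cone P F)"
proof (rule convexI)
  fix x y :: "'a rvec" and u v :: real
  assume "x \<in> inner_normal_cone P F" "y \<in> inner_normal_cone P F" "0 \<le> u" "0 \<le> v"
  then show "u *\<^sub>R x + v *\<^sub>R y \<in> inner_normal_cone P F"
    by (auto simp: inner_normal_cone_def inner_add_right intro!: add_mono mult_left_mono)
qed

lemma zero_in_inner_normal_cone: "0 \<in> inner_normal_cone P F"
  by (simp add: inner_normal_cone_def)

lemma convex_normal_fan: "\<sigma> \<in> normal_fan P \<Longrightarrow> convex \<sigma>"
  by (auto simp: normal_fan_def convex_inner_normal_cone)

lemma normal_fan_nonempty: "\<sigma> \<in> normal_fan P \<Longrightarrow> \<sigma> \<noteq> {}"
  using zero_in_inner_normal_cone by (fastforce simp: normal_fan_def)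

lemma dual_cone_zero: "0 \<in> dual_cone \<sigma>"
  by (simp add: dual_cone_def)

lemma dual_cone_add: "u \<in> dual_cone \<sigma> \<Longrightarrow> v \<in> dual_cone \<sigma> \<Longrightarrow> u + v \<in> dual_cone \<sigma>"
  by (simp add: dual_cone_def inner_add_left)

lemma dual_cone_scale: "u \<in> dual_cone \<sigma> \<Longrightarrow> 0 \<le> t \<Longrightarrow> t *\<^sub>R u \<in> dual_cone \<sigma>"
  by (simp add: dual_cone_def)

text \<open>\<open>P\<close> lies in the cone with apex \<open>u\<close>, and the apex belongs to
  \<open>P\<close>, so the Minkowski sum is just that cone. Every later question about \<Delta>^+ +
  \<tau>^dual becomes a sign condition on one difference.\<close>

lemma plus_dual_cone_iff:
  assumes "u \<in> P" "\<And>w. w \<in> P \<Longrightarrow> w - u \<in> dual_cone \<sigma>"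
  shows "z \<in> P + dual_cone \<sigma> \<longleftrightarrow> z - u \<in> dual_cone \<sigma>"
proof
  assume "z \<in> P + dual_cone \<sigma>"
  then obtain w v where wv: "w \<in> P" "v \<in> dual_cone \<sigma>" "z = w + v" by (auto simp: set_plus_def)
  have "z - u = (w - u) + v" using wv(3) by simp
  then show "z - u \<in> dual_cone \<sigma>" using dual_cone_add[OF assms(2)[OF wv(1)] wv(2)] by (simp only:)
next
  assume "z - u \<in> dual_cone \<sigma>"
  moreover have "z = u + (z - u)" by simp
  ultimately show "z \<in> P + dual_cone \<sigma>" using assms(1) by (metis set_plus_intro)
qed

lemma real_pt_zero [simp]: "real_pt 0 = 0"
  by (simp add: real_pt_def vec_eq_iff)

lemma real_pt_add: "real_pt (m + m') = real_pt m + real_pt m'"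
  by (simp add: real_pt_def vec_eq_iff lookup_add)

lemma real_pt_minus: "real_pt (m - m') = real_pt m - real_pt m'"
  by (simp add: real_pt_def vec_eq_iff lookup_minus)

lemma Pol_plus_vertex:
  assumes "\<Sigma> = normal_fan \<Delta>" "P \<in> Pol_plus \<Sigma>" "P \<noteq> {}" "\<sigma> \<in> \<Sigma>"
  shows "\<exists>m. real_pt m \<in> P \<and> (\<forall>w\<in>P. w - real_pt m \<in> dual_cone \<sigma>)"
proof -
  have P: "lattice_polyhedron P" and "\<exists>l. linear l \<and> (\<forall>v\<in>\<sigma>. is_min_on P v (l v))"
    using assms by (auto simp: Pol_plus_def)
  then show ?thesis
    using assms convex_normal_fan normal_fan_nonempty
    by (metis lattice_polyhedron_vertex_on_cone)
qed

text \<open>For \<open>u\<close> in the face defining \<sigma>, the translate \<Delta> - u lies in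
  the dual of \<sigma>. Thus the dual cone inherits the full dimension of \<Delta>.\<close>

lemma interior_dual_cone_normal_fan:
  fixes \<Delta> :: "'d::finite rvec set"
  assumes \<Delta>: "polyhedron \<Delta>" "aff_dim \<Delta> = int CARD('d)" and \<sigma>: "\<sigma> \<in> normal_fan \<Delta>"
  shows "interior (dual_cone \<sigma>) \<noteq> {}"
proof -
  obtain F where F: "\<sigma> = inner_normal_cone \<Delta> F" "F face_of \<Delta>" "F \<noteq> {}"
    using \<sigma> by (auto simp: normal_fan_def)
  then obtain u where u: "u \<in> F" by blast
  have sub: "(\<lambda>w. w - u) ` \<Delta> \<subseteq> dual_cone \<sigma>"
    using u by (auto simp: F(1) dual_cone_def inner_normal_cone_def inner_diff_left)
  have "aff_dim \<Delta> = DIM('d rvec)" using \<Delta>(2) by simp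
  moreover have "convex \<Delta>" using \<Delta>(1) polyhedron_imp_convex by blast
  ultimately have "interior \<Delta> \<noteq> {}"
    using interior_rel_interior_gen[of \<Delta>] rel_interior_eq_empty[of \<Delta>] aff_dim_empty[of \<Delta>] by auto
  then have "interior ((\<lambda>w. w - u) ` \<Delta>) \<noteq> {}"
    using interior_translation_subtract[of u \<Delta>] by simp
  then show ?thesis using interior_mono[OF sub] by blast
qed

text \<open>A cone with interior contains arbitrarily large balls: far out in the direction of an
  interior point there is room both for rounding to the lattice and for all shifts by
  \<open>A\<close>. It serves to clear the exponents of a rational function by one monomial.\<close>

lemma lattice_point_translates_into_dual_cone:
  fixes \<sigma> :: "'d::finite rvec set"
  assumes int: "interior (dual_cone \<sigma>) \<noteq> {}" and A: "finite A"
  shows "\<exists>m. real_pt m \<in> dual_cone \<sigma> \<and> (\<forall>a\<in>A. real_pt (a + m) \<in> dual_cone \<sigma>)"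
proof -
  obtain c r where r: "r > 0" "ball c r \<subseteq> dual_cone \<sigma>"
    using int by (meson ex_in_conv mem_interior)
  have big: "x \<in> dual_cone \<sigma>" if "norm (x - t *\<^sub>R c) < t * r" "t > 0" for x t
  proof -
    have "norm ((1/t) *\<^sub>R x - c) < r"
    proof -
      have "norm ((1/t) *\<^sub>R x - c) = norm (x - t *\<^sub>R c) / t"
        using that(2) norm_scaleR[of "1/t" "x - t *\<^sub>R c"] by (simp add: scaleR_diff_right)
      then show ?thesis using that by (simp add: divide_less_eq mult.commute)
    qed
    then have "(1/t) *\<^sub>R x \<in> dual_cone \<sigma>"
      using r(2) by (auto simp: dist_norm norm_minus_commute)
    then have "t *\<^sub>R ((1/t) *\<^sub>R x) \<in> dual_cone \<sigma>" by (rule dual_cone_scale) (use that(2) in simp)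
    then show ?thesis using that(2) by simp
  qed
  \<comment> \<open>The radius needed: \<open>CARD('d)\<close> bounds the rounding error, each
    coordinate contributing at most 1, the sum bounds the norm of every shift, and 1 makes the
    estimate strict. Then \<open>t\<close> scales the ball of radius \<open>r\<close> to radius
    \<open>B\<close>.\<close>
  define B where "B = CARD('d) + (\<Sum>a\<in>A. norm (real_pt a)) + 1"
  define t where "t = B / r"
  have sum0: "(\<Sum>a\<in>A. norm (real_pt a)) \<ge> 0" by (simp add: sum_nonneg)
  then have B: "B > 0" by (simp add: B_def add_nonneg_pos)
  have t: "t > 0" "t * r = B" using r B by (auto simp: t_def)
  define m where "m = Abs_poly_mapping (\<lambda>i. \<lfloor>(t *\<^sub>R c) $ i\<rfloor>)"
  have lm: "Poly_Mapping.lookup m i = \<lfloor>(t *\<^sub>R c) $ i\<rfloor>" for i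
    unfolding m_def by (subst Abs_poly_mapping_inverse) auto
  have nm: "norm (real_pt m - t *\<^sub>R c) \<le> CARD('d)"
  proof -
    have "norm (real_pt m - t *\<^sub>R c) \<le> (\<Sum>i\<in>UNIV. \<bar>(real_pt m - t *\<^sub>R c) $ i\<bar>)"
      by (rule norm_le_l1_cart)
    also have "\<dots> \<le> (\<Sum>i\<in>(UNIV :: 'd set). 1)"
    proof (rule sum_mono)
      fix i
      have "real_of_int \<lfloor>t * c $ i\<rfloor> \<le> t * c $ i" "t * c $ i < real_of_int \<lfloor>t * c $ i\<rfloor> + 1" by linarith+
      then show "\<bar>(real_pt m - t *\<^sub>R c) $ i\<bar> \<le> 1"
        by (simp add: real_pt_def lm, linarith)
    qed
    finally show ?thesis by simp
  qed
  have "real_pt (a + m) \<in> dual_cone \<sigma>" if "a \<in> A" for a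
  proof (rule big[OF _ t(1)])
    have "norm (real_pt (a + m) - t *\<^sub>R c) \<le> norm (real_pt a) + norm (real_pt m - t *\<^sub>R c)"
      by (metis norm_triangle_ineq real_pt_add add_diff_eq)
    moreover have "norm (real_pt a) \<le> (\<Sum>a\<in>A. norm (real_pt a))"
      using that A by (intro member_le_sum) auto
    ultimately show "norm (real_pt (a + m) - t *\<^sub>R c) < t * r"
      using nm t(2) by (simp add: B_def)
  qed
  moreover have "real_pt m \<in> dual_cone \<sigma>"
    by (rule big[OF _ t(1)]) (use nm t(2) sum0 in \<open>simp add: B_def\<close>)
  ultimately show ?thesis by blast
qed

text \<open>If \<open>z\<close> is outside the cone with apex \<open>p\<close>, some
  \<open>v\<close> in \<sigma> is negative on \<open>z - p\<close>. As \<open>u\<close> minimises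
  \<open>v\<close> on \<open>Q\<close> and \<open>p\<close> belongs to \<open>Q\<close>,
  \<open>v\<close> is at most 0 on \<open>u - p\<close>. Hence \<open>v\<close> stays negative along
  the segment from \<open>u\<close> to \<open>z\<close>, except perhaps at the end \<open>u\<close>,
  which is treated separately.\<close>

lemma connected_local_difference:
  fixes P Q :: "'d::finite rvec set"
  assumes Q: "convex Q" "u \<in> Q" "\<And>w. w \<in> Q \<Longrightarrow> w - u \<in> dual_cone \<sigma>"
    and P: "P \<subseteq> Q" "p \<in> P" "\<And>w. w \<in> P \<Longrightarrow> w - p \<in> dual_cone \<sigma>"
    and ne: "Q - (P + dual_cone \<sigma>) \<noteq> {}"
  shows "u \<in> Q - (P + dual_cone \<sigma>) \<and> connected (Q - (P + dual_cone \<sigma>))"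
proof -
  let ?S = "Q - (P + dual_cone \<sigma>)"
  have S: "z \<in> ?S \<longleftrightarrow> z \<in> Q \<and> z - p \<notin> dual_cone \<sigma>" for z
    using plus_dual_cone_iff[OF P(2,3)] by blast
  \<comment> \<open>Otherwise the cone with apex \<open>p\<close> would contain the one with apex
    \<open>u\<close>, hence all of \<open>Q\<close>, and the difference would be empty.\<close>
  have up: "u - p \<notin> dual_cone \<sigma>"
  proof
    assume up: "u - p \<in> dual_cone \<sigma>"
    obtain z where "z \<in> ?S" using ne by blast
    then have "z - u \<in> dual_cone \<sigma>" "z - p \<notin> dual_cone \<sigma>" using S Q(3) by blast+
    then show False using dual_cone_add[OF _ up, of "z - u"] by simp
  qed
  then have uS: "u \<in> ?S" using S Q(2) by blast
  have "closed_segment u z \<subseteq> ?S" if z: "z \<in> ?S" for z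
  proof
    fix y assume "y \<in> closed_segment u z"
    then obtain t where t: "0 \<le> t" "t \<le> 1" "y = (1 - t) *\<^sub>R u + t *\<^sub>R z"
      by (auto simp: closed_segment_def)
    have "y \<in> Q" using t Q(1,2) z by (auto simp: convex_alt)
    moreover have "y - p \<notin> dual_cone \<sigma>"
    proof (cases "t = 0")
      case False
      obtain v where v: "v \<in> \<sigma>" "(z - p) \<bullet> v < 0"
        using conjunct2[OF S[THEN iffD1, OF z]] by (auto simp: dual_cone_def not_le)
      have "(p - u) \<bullet> v \<ge> 0" using Q(3)[of p] P(1,2) v(1) by (auto simp: dual_cone_def)
      then have "(1 - t) * ((u - p) \<bullet> v) \<le> 0"
        using t by (intro mult_nonneg_nonpos) (simp_all add: inner_diff_left)
      moreover have "t * ((z - p) \<bullet> v) < 0" using t False v(2) by (simp add: mult_pos_neg)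
      moreover have "(y - p) \<bullet> v = (1 - t) * ((u - p) \<bullet> v) + t * ((z - p) \<bullet> v)"
        by (simp add: t(3) inner_diff_left inner_add_left algebra_simps)
      ultimately have "(y - p) \<bullet> v < 0" by linarith
      then show ?thesis using v(1) by (force simp: dual_cone_def)
    qed (use t up in simp)
    ultimately show "y \<in> ?S" using S by blast
  qed
  then have "starlike ?S" using uS unfolding starlike_def by blast
  then show ?thesis using uS starlike_imp_connected by blast
qed

text \<open>Components are relatively closed; when there are finitely many, the union of the others
  is closed as well.\<close>

lemma openin_component:
  assumes fin: "finite (components Z)" and C: "C \<in> components Z"
  shows "openin (top_of_set Z) C"
proof -
  have "Z - C = \<Union>(components Z - {C})"
  proof
    show "Z - C \<subseteq> \<Union>(components Z - {C})" using Union_components[of Z] by blast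
    show "\<Union>(components Z - {C}) \<subseteq> Z - C"
    proof
      fix z assume "z \<in> \<Union>(components Z - {C})"
      then obtain B where B: "B \<in> components Z" "B \<noteq> C" "z \<in> B" by blast
      then have "z \<notin> C" using components_eq[OF C B(1)] by blast
      then show "z \<in> Z - C" using in_components_subset[OF B(1)] B(3) by blast
    qed
  qed
  moreover have "closedin (top_of_set Z) (\<Union>(components Z - {C}))"
    using fin by (intro closedin_Union) (auto intro: closedin_component)
  ultimately have "closedin (top_of_set Z) (Z - C)" by simp
  then show ?thesis using in_components_subset[OF C] by (simp add: openin_closedin_eq)
qed

text \<open>The component is open and closed in \<open>Z\<close>, so any neighbourhood of
  \<open>x\<close> can be cut down to the side of \<open>C\<close> on which \<open>x\<close>
  lies.\<close>

lemma indicator_component_loc_const: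
  assumes fin: "finite (components Z)" and C: "C \<in> components Z"
  shows "indicator C \<in> loc_const Z"
  unfolding loc_const_def mem_Collect_eq locally_def
proof (intro allI impI)
  fix w x assume w: "openin (top_of_set Z) w \<and> x \<in> w"
  define N where "N = (if x \<in> C then w \<inter> C else w - C)"
  have "openin (top_of_set Z) N"
    unfolding N_def using w openin_component[OF fin C] closedin_component[OF C] by auto
  moreover have "(indicator C :: 'a \<Rightarrow> complex) constant_on N"
    unfolding constant_on_def N_def by (auto simp: indicator_def)
  moreover have "x \<in> N" "N \<subseteq> w" unfolding N_def using w by auto
  ultimately show "\<exists>U V. openin (top_of_set Z) U \<and> (indicator C :: 'a \<Rightarrow> complex) constant_on V \<and>
      x \<in> U \<and> U \<subseteq> V \<and> V \<subseteq> w"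
    by blast
qed

section \<open>Charts and local rings\<close>

definition monom_fun :: "('d \<Rightarrow>\<^sub>0 int) \<Rightarrow> 'd::{finite,linorder} ratfun" where
  "monom_fun m = Fract (Poly_Mapping.single m 1) 1"

lemma monom_fun_0 [simp]: "monom_fun 0 = 1"
  by (simp add: monom_fun_def One_fract_def)

lemma monom_fun_mult: "monom_fun m * monom_fun m' = monom_fun (m + m')"
  by (simp add: monom_fun_def mult_single)

lemma monom_fun_nonzero [simp]: "monom_fun m \<noteq> 0"
proof
  assume "monom_fun m = 0"
  then have "monom_fun m * monom_fun (- m) = 0" by simp
  then show False by (simp only: monom_fun_mult) simp
qed

lemma monom_fun_diff: "monom_fun (m - m') = monom_fun m / monom_fun m'"
  using monom_fun_mult[of "m - m'" m'] by (simp add: field_simps)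

lemma laurent_spanI: "Poly_Mapping.keys q \<subseteq> A \<Longrightarrow> Fract q 1 \<in> laurent_span A"
  unfolding laurent_span_def by blast

lemma laurent_spanE:
  assumes "f \<in> laurent_span A"
  obtains q where "f = Fract q 1" "Poly_Mapping.keys q \<subseteq> A"
  using assms unfolding laurent_span_def by blast

lemma laurent_span_add: "f \<in> laurent_span A \<Longrightarrow> g \<in> laurent_span A \<Longrightarrow> f + g \<in> laurent_span A"
proof -
  assume "f \<in> laurent_span A" "g \<in> laurent_span A"
  then obtain p q where "f = Fract p 1" "g = Fract q 1"
    "Poly_Mapping.keys p \<subseteq> A" "Poly_Mapping.keys q \<subseteq> A"
    by (elim laurent_spanE)
  moreover from this have "Poly_Mapping.keys (p + q) \<subseteq> A" using keys_add[of p q] by blast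
  ultimately show ?thesis using laurent_spanI[of "p + q" A] by simp
qed

lemma laurent_span_uminus: "f \<in> laurent_span A \<Longrightarrow> - f \<in> laurent_span A"
  by (elim laurent_spanE) (metis laurent_spanI keys_minus minus_fract)

lemma laurent_span_zero: "0 \<in> laurent_span A"
  unfolding Zero_fract_def by (rule laurent_spanI) simp

lemma laurent_span_sum: "(\<And>i. i \<in> I \<Longrightarrow> f i \<in> laurent_span A) \<Longrightarrow> sum f I \<in> laurent_span A"
  by (induction I rule: infinite_finite_induct) (auto simp: laurent_span_zero laurent_span_add)

lemma laurent_span_mult:
  assumes "f \<in> laurent_span A" "g \<in> laurent_span B" "\<And>a b. a \<in> A \<Longrightarrow> b \<in> B \<Longrightarrow> a + b \<in> C"
  shows "f * g \<in> laurent_span C"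
proof -
  obtain p q where pq: "f = Fract p 1" "g = Fract q 1"
    "Poly_Mapping.keys p \<subseteq> A" "Poly_Mapping.keys q \<subseteq> B"
    using assms(1,2) by (elim laurent_spanE)
  then have "Poly_Mapping.keys (p * q) \<subseteq> C" using keys_mult[of p q] assms(3) by blast
  then show ?thesis using pq laurent_spanI[of "p * q" C] by simp
qed

lemma monom_fun_in_laurent_span: "m \<in> A \<Longrightarrow> monom_fun m \<in> laurent_span A"
  unfolding monom_fun_def by (rule laurent_spanI) simp

lemma const_fun_in_laurent_span: "0 \<in> A \<Longrightarrow> const_fun c \<in> laurent_span A"
  unfolding const_fun_def by (rule laurent_spanI) simp

lemma const_fun_0 [simp]: "const_fun 0 = 0"
  by (simp add: const_fun_def Zero_fract_def)

lemma const_fun_1 [simp]: "const_fun 1 = 1"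
  by (simp add: const_fun_def One_fract_def)

lemma const_fun_diff: "const_fun (a - b) = const_fun a - const_fun b"
  by (simp add: const_fun_def single_diff)

lemma const_fun_add: "const_fun (a + b) = const_fun a + const_fun b"
  by (simp add: const_fun_def single_add)

lemma carrier_chart_ring:
  "carrier (chart_ring \<sigma>) = laurent_span {m. real_pt m \<in> dual_cone \<sigma>}"
  by (simp add: chart_ring_def)

lemma chart_ring_simps [simp]:
  "mult (chart_ring \<sigma>) = (*)" "one (chart_ring \<sigma>) = 1"
  "zero (chart_ring \<sigma>) = 0" "add (chart_ring \<sigma>) = (+)"
  by (simp_all add: chart_ring_def)

lemma chart_ring_closed:
  fixes \<sigma> :: "'d::{finite,linorder} rvec set"
  shows "0 \<in> carrier (chart_ring \<sigma>)" "1 \<in> carrier (chart_ring \<sigma>)"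
    "f \<in> carrier (chart_ring \<sigma>) \<Longrightarrow> g \<in> carrier (chart_ring \<sigma>) \<Longrightarrow> f + g \<in> carrier (chart_ring \<sigma>)"
    "f \<in> carrier (chart_ring \<sigma>) \<Longrightarrow> g \<in> carrier (chart_ring \<sigma>) \<Longrightarrow> f * g \<in> carrier (chart_ring \<sigma>)"
    "f \<in> carrier (chart_ring \<sigma>) \<Longrightarrow> - f \<in> carrier (chart_ring \<sigma>)"
proof -
  show "1 \<in> carrier (chart_ring \<sigma>)"
    unfolding carrier_chart_ring
    using monom_fun_in_laurent_span[of 0 "{m. real_pt m \<in> dual_cone \<sigma>}"]
    by (simp add: dual_cone_zero)
  show "f \<in> carrier (chart_ring \<sigma>) \<Longrightarrow> g \<in> carrier (chart_ring \<sigma>) \<Longrightarrow> f * g \<in> carrier (chart_ring \<sigma>)"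
    unfolding carrier_chart_ring
    by (erule laurent_span_mult, assumption) (simp add: real_pt_add dual_cone_add)
qed (simp_all add: carrier_chart_ring laurent_span_zero laurent_span_add laurent_span_uminus)

lemma cring_chart_ring: "cring (chart_ring \<sigma>)"
proof (rule cringI)
  show "abelian_group (chart_ring \<sigma>)"
  proof (rule abelian_groupI)
    fix x assume "x \<in> carrier (chart_ring \<sigma>)"
    then show "\<exists>y\<in>carrier (chart_ring \<sigma>). y \<oplus>\<^bsub>chart_ring \<sigma>\<^esub> x = \<zero>\<^bsub>chart_ring \<sigma>\<^esub>"
      by (intro bexI[of _ "- x"]) (simp_all add: chart_ring_closed)
  qed (simp_all add: chart_ring_closed algebra_simps)
  show "Group.comm_monoid (chart_ring \<sigma>)"
    by (rule comm_monoidI) (simp_all add: chart_ring_closed algebra_simps)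
qed (simp add: algebra_simps)

text \<open>This prime is the generic point of the chart; primality comes from the chart ring being
  a subring of a field.\<close>

lemma zero_primeideal_chart_ring: "primeideal {0} (chart_ring \<sigma>)"
proof (rule primeidealI)
  show "ideal {0} (chart_ring \<sigma>)"
    using ring.zeroideal[OF cring.axioms(1)[OF cring_chart_ring], of \<sigma>] by simp
  show "cring (chart_ring \<sigma>)" by (rule cring_chart_ring)
  show "carrier (chart_ring \<sigma>) \<noteq> {0}"
  proof
    assume "carrier (chart_ring \<sigma>) = {0}"
    then have "1 \<in> {0 :: 'a ratfun}"
      using chart_ring_closed(2)[of \<sigma>] by metis
    then show False by (metis singletonD zero_neq_one)
  qed
  fix a b
  assume "a \<otimes>\<^bsub>chart_ring \<sigma>\<^esub> b \<in> {0}"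
  then show "a \<in> {0} \<or> b \<in> {0}"
    by (metis chart_ring_simps(1) mult_eq_0_iff singleton_iff)
qed

text \<open>The local ring of the generic point is the whole function field.\<close>

lemma generic_point_in_chart:
  fixes \<sigma> :: "'d::{finite,linorder} rvec set"
  assumes tr: "\<And>A. finite A \<Longrightarrow>
    \<exists>m. real_pt m \<in> dual_cone \<sigma> \<and> (\<forall>a\<in>A. real_pt (a + m) \<in> dual_cone \<sigma>)"
  shows "UNIV \<in> chart \<sigma>"
proof -
  have "f \<in> local_ring (chart_ring \<sigma>) {0}" for f :: "'d ratfun"
  proof -
    obtain p q where f: "f = Fract p q" "q \<noteq> 0" by (cases f)
    \<comment> \<open>Multiplying numerator and denominator by this one monomial moves both into the
      chart ring without changing the fraction.\<close>
    obtain m where m: "real_pt m \<in> dual_cone \<sigma>"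
      "\<And>a. a \<in> Poly_Mapping.keys p \<union> Poly_Mapping.keys q \<Longrightarrow> real_pt (a + m) \<in> dual_cone \<sigma>"
      using tr[of "Poly_Mapping.keys p \<union> Poly_Mapping.keys q"] by auto
    have mem: "Fract r 1 * monom_fun m \<in> carrier (chart_ring \<sigma>)"
      if "Poly_Mapping.keys r \<subseteq> Poly_Mapping.keys p \<union> Poly_Mapping.keys q" for r
    proof -
      have "Fract r 1 \<in> laurent_span (Poly_Mapping.keys r)" by (rule laurent_spanI) simp
      moreover have "monom_fun m \<in> laurent_span {m}" by (simp add: monom_fun_in_laurent_span)
      ultimately show ?thesis
        unfolding carrier_chart_ring by (rule laurent_span_mult) (use m(2) that in auto)
    qed
    have "f = (Fract p 1 * monom_fun m) / (Fract q 1 * monom_fun m)"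
      using f(1) by simp
    moreover have "Fract q 1 \<noteq> 0"
      unfolding Zero_fract_def using f(2) by (simp add: eq_fract)
    then have "Fract q 1 * monom_fun m \<noteq> 0"
      by simp
    ultimately show ?thesis
      unfolding local_ring_def localize_def using mem[of p] mem[of q] by blast
  qed
  then have "local_ring (chart_ring \<sigma>) {0} = UNIV" by blast
  then show ?thesis
    using zero_primeideal_chart_ring unfolding chart_def Spec_def by fastforce
qed

lemma prime_chart_ring:
  assumes p: "p \<in> Spec (chart_ring \<sigma>)"
  shows "0 \<in> p" "1 \<notin> p"
    and "b \<in> carrier (chart_ring \<sigma>) \<Longrightarrow> c \<in> carrier (chart_ring \<sigma>) \<Longrightarrow> b \<notin> p \<Longrightarrow> c \<notin> p \<Longrightarrow> b * c \<notin> p"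
proof -
  have prime: "primeideal p (chart_ring \<sigma>)" using p by (simp add: Spec_def)
  have ideal: "ideal p (chart_ring \<sigma>)" using primeideal.axioms(1)[OF prime] .
  show "0 \<in> p"
    using additive_subgroup.zero_closed[OF ideal.axioms(1)[OF ideal]] by simp
  show "1 \<notin> p"
    using ideal.one_imp_carrier[OF ideal] primeideal.I_notcarr[OF prime] by auto
  show "b \<in> carrier (chart_ring \<sigma>) \<Longrightarrow> c \<in> carrier (chart_ring \<sigma>) \<Longrightarrow> b \<notin> p \<Longrightarrow> c \<notin> p \<Longrightarrow> b * c \<notin> p"
    using primeideal.I_prime[OF prime, of b c] by auto
qed

lemma local_ring_closed:
  fixes \<sigma> :: "'d::{finite,linorder} rvec set"
  assumes x: "x \<in> chart \<sigma>"
  shows carrier_subset_local_ring: "f \<in> carrier (chart_ring \<sigma>) \<Longrightarrow> f \<in> x"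
    and local_ring_add: "f \<in> x \<Longrightarrow> g \<in> x \<Longrightarrow> f + g \<in> x"
    and local_ring_mult: "f \<in> x \<Longrightarrow> g \<in> x \<Longrightarrow> f * g \<in> x"
proof -
  obtain p where p: "p \<in> Spec (chart_ring \<sigma>)" "x = local_ring (chart_ring \<sigma>) p"
    using x by (auto simp: chart_def)
  note one = prime_chart_ring(2)[OF p(1)] and zero = prime_chart_ring(1)[OF p(1)]
    and prime = prime_chart_ring(3)[OF p(1)] chart_ring_closed(4)[of _ \<sigma>]
  show "f \<in> carrier (chart_ring \<sigma>) \<Longrightarrow> f \<in> x"
    unfolding p(2) local_ring_def localize_def using one chart_ring_closed(2) by force
  assume "f \<in> x" "g \<in> x"
  then obtain a b c d where f: "f = a / b" "a \<in> carrier (chart_ring \<sigma>)" "b \<in> carrier (chart_ring \<sigma>)" "b \<notin> p"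
    and g: "g = c / d" "c \<in> carrier (chart_ring \<sigma>)" "d \<in> carrier (chart_ring \<sigma>)" "d \<notin> p"
    unfolding p(2) local_ring_def localize_def by blast
  have "b \<noteq> 0" "d \<noteq> 0" using f g zero by auto
  then have "f + g = (a * d + c * b) / (b * d)" "f * g = (a * c) / (b * d)"
    using f g by (simp_all add: field_simps)
  moreover have "a * d + c * b \<in> carrier (chart_ring \<sigma>)" "a * c \<in> carrier (chart_ring \<sigma>)"
    using f g by (simp_all add: chart_ring_closed)
  ultimately show "f + g \<in> x" "f * g \<in> x"
    unfolding p(2) local_ring_def localize_def using prime f g by blast+
qed

text \<open>The quotient is the character of \<open>m - m'\<close>, which is regular on the whole
  chart. All comparisons of line bundles below reduce to this.\<close>

lemma monom_quotient_in_local_ring: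
  assumes "x \<in> chart \<sigma>" "real_pt m - real_pt m' \<in> dual_cone \<sigma>"
  shows "monom_fun m / monom_fun m' \<in> x"
proof -
  have "monom_fun (m - m') \<in> carrier (chart_ring \<sigma>)"
    unfolding carrier_chart_ring using assms(2)
    by (intro monom_fun_in_laurent_span) (simp add: real_pt_minus)
  then show ?thesis using carrier_subset_local_ring[OF assms(1)] monom_fun_diff by metis
qed

lemma local_ring_facts:
  fixes \<sigma> :: "'d::{finite,linorder} rvec set"
  assumes x: "x \<in> chart \<sigma>"
  shows local_ring_zero: "0 \<in> x" and local_ring_one: "1 \<in> x"
    and local_ring_uminus: "f \<in> x \<Longrightarrow> - f \<in> x"
    and local_ring_sum: "(\<And>i. i \<in> I \<Longrightarrow> F i \<in> x) \<Longrightarrow> sum F I \<in> x"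
    and local_ring_const: "const_fun c \<in> x"
proof -
  show zero: "0 \<in> x" "1 \<in> x"
    by (intro carrier_subset_local_ring[OF x] chart_ring_closed)+
  show "const_fun c \<in> x"
    using x by (intro carrier_subset_local_ring[OF x])
      (simp add: carrier_chart_ring const_fun_in_laurent_span dual_cone_zero)
  have "- 1 \<in> x"
    by (intro carrier_subset_local_ring[OF x] chart_ring_closed)
  then show "f \<in> x \<Longrightarrow> - f \<in> x" using local_ring_mult[OF x, of "- 1" f] by simp
  show "(\<And>i. i \<in> I \<Longrightarrow> F i \<in> x) \<Longrightarrow> sum F I \<in> x"
    by (induction I rule: infinite_finite_induct) (simp_all add: zero local_ring_add[OF x])
qed

text \<open>The complement of the locus is cut out by the ideal of denominators of \<open>f\<close>.\<close>

lemma zariski_open_regular_locus: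
  "zariski_open (chart_ring \<sigma>) {p \<in> Spec (chart_ring \<sigma>). f \<in> local_ring (chart_ring \<sigma>) p}"
proof -
  let ?R = "chart_ring \<sigma>" let ?E = "{b \<in> carrier ?R. b * f \<in> carrier ?R}"
  have "f \<in> local_ring ?R p \<longleftrightarrow> \<not> ?E \<subseteq> p" if p: "p \<in> Spec ?R" for p
  proof -
    note zero = prime_chart_ring(1)[OF p]
    show ?thesis
    proof
      assume "f \<in> local_ring ?R p"
      then obtain a b where ab: "f = a / b" "a \<in> carrier ?R" "b \<in> carrier ?R" "b \<notin> p"
        unfolding local_ring_def localize_def by blast
      moreover have "b \<noteq> 0" using ab zero by auto
      ultimately show "\<not> ?E \<subseteq> p" by auto
    next
      assume "\<not> ?E \<subseteq> p"
      then obtain b where b: "b \<in> carrier ?R" "b * f \<in> carrier ?R" "b \<notin> p" by blast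
      then have "f = (b * f) / b" using zero by auto
      then show "f \<in> local_ring ?R p"
        unfolding local_ring_def localize_def using b by blast
    qed
  qed
  then show ?thesis unfolding zariski_open_def by (intro exI[of _ ?E]) auto
qed

section \<open>Sheaves given by local equations\<close>

text \<open>
  One local equation \<open>h \<sigma>\<close> per chart, as for a Cartier divisor. Equations on different charts agree up to
  a unit, since \<open>\<sigma>\<close> and \<open>\<tau>\<close> may be exchanged in the condition on \<open>h \<sigma> / h \<tau>\<close>.
\<close>

definition div_sheaf ::
    "'d rvec set set \<Rightarrow> ('d rvec set \<Rightarrow> 'd::{finite,linorder} ratfun) \<Rightarrow>
     'd ratfun set set \<Rightarrow> 'd ratfun set" where
  "div_sheaf \<Sigma> h V =
     {f. (V = {} \<longrightarrow> f = 0) \<and> (\<forall>\<sigma>\<in>\<Sigma>. \<forall>x\<in>V \<inter> chart \<sigma>. f / h \<sigma> \<in> x)}"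

definition local_equations ::
    "'d rvec set set \<Rightarrow> ('d rvec set \<Rightarrow> 'd::{finite,linorder} ratfun) \<Rightarrow> bool" where
  "local_equations \<Sigma> h \<longleftrightarrow> (\<forall>\<sigma>\<in>\<Sigma>. h \<sigma> \<noteq> 0) \<and>
     (\<forall>\<sigma>\<in>\<Sigma>. \<forall>\<tau>\<in>\<Sigma>. \<forall>x\<in>chart \<sigma> \<inter> chart \<tau>. h \<sigma> / h \<tau> \<in> x)"

lemma local_equations_nonzero: "local_equations \<Sigma> h \<Longrightarrow> \<sigma> \<in> \<Sigma> \<Longrightarrow> h \<sigma> \<noteq> 0"
  by (simp add: local_equations_def)

lemma local_equations_quotient:
  "local_equations \<Sigma> h \<Longrightarrow> \<sigma> \<in> \<Sigma> \<Longrightarrow> \<tau> \<in> \<Sigma> \<Longrightarrow> x \<in> chart \<sigma> \<Longrightarrow> x \<in> chart \<tau> \<Longrightarrow> h \<sigma> / h \<tau> \<in> x"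
  by (simp add: local_equations_def)

text \<open>The quotient of the two equations lies in the local ring, so a single chart through
  \<open>x\<close> decides whether \<open>f\<close> belongs to the stalk.\<close>

lemma local_equations_change:
  assumes h: "local_equations \<Sigma> h" and \<sigma>: "\<sigma> \<in> \<Sigma>" "x \<in> chart \<sigma>" and \<tau>: "\<tau> \<in> \<Sigma>" "x \<in> chart \<tau>"
    and f: "f / h \<sigma> \<in> x"
  shows "f / h \<tau> \<in> x"
proof -
  have "f / h \<tau> = (f / h \<sigma>) * (h \<sigma> / h \<tau>)"
    using local_equations_nonzero[OF h \<sigma>(1)] by simp
  then show ?thesis
    by (simp only:) (rule local_ring_mult[OF \<sigma>(2) f local_equations_quotient[OF h \<sigma>(1) \<tau>(1) \<sigma>(2) \<tau>(2)]])
qed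

lemma local_equations_divide:
  assumes h: "local_equations \<Sigma> h" and g: "local_equations \<Sigma> g"
  shows "local_equations \<Sigma> (\<lambda>\<sigma>. h \<sigma> / g \<sigma>)"
  unfolding local_equations_def
proof (intro conjI ballI)
  fix \<sigma> assume "\<sigma> \<in> \<Sigma>"
  then show "h \<sigma> / g \<sigma> \<noteq> 0" using local_equations_nonzero h g by (metis divide_eq_0_iff)
next
  fix \<sigma> \<tau> x assume st: "\<sigma> \<in> \<Sigma>" "\<tau> \<in> \<Sigma>" and x: "x \<in> chart \<sigma> \<inter> chart \<tau>"
  have "(h \<sigma> / h \<tau>) * (g \<tau> / g \<sigma>) \<in> x"
    using local_ring_mult[of x \<sigma>] local_equations_quotient[OF h] local_equations_quotient[OF g] st x
    by blast
  moreover have "(h \<sigma> / g \<sigma>) / (h \<tau> / g \<tau>) = (h \<sigma> / h \<tau>) * (g \<tau> / g \<sigma>)"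
    by (simp add: mult.commute)
  ultimately show "(h \<sigma> / g \<sigma>) / (h \<tau> / g \<tau>) \<in> x" by (simp only:)
qed

lemma local_equations_one: "local_equations \<Sigma> (\<lambda>\<sigma>. 1)"
  unfolding local_equations_def using local_ring_one by auto

lemma local_equations_inverse:
  "local_equations \<Sigma> h \<Longrightarrow> local_equations \<Sigma> (\<lambda>\<sigma>. inverse (h \<sigma>))"
  using local_equations_divide[OF local_equations_one] by (simp add: inverse_eq_divide)

lemma openin_chartE:
  assumes "openin (toric_variety \<Sigma>) V" "x \<in> V"
  obtains \<sigma> where "\<sigma> \<in> \<Sigma>" "x \<in> chart \<sigma>"
  using assms openin_subset topspace_toric_variety by blast

text \<open>In each chart this is the regular locus of the single function
  \<open>f / h \<sigma>\<close>, because the conditions from other charts follow at common points.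
  The set is the largest open set on which \<open>f\<close> is a section, and it supplies the
  neighbourhoods to which local sections are extended.\<close>

lemma openin_local_sections:
  assumes h: "local_equations \<Sigma> h"
  shows "openin (toric_variety \<Sigma>)
    {x \<in> topspace (toric_variety \<Sigma>). \<forall>\<sigma>\<in>\<Sigma>. x \<in> chart \<sigma> \<longrightarrow> f / h \<sigma> \<in> x}" (is "openin _ ?V")
  unfolding openin_toric_variety
proof (intro conjI ballI)
  show "?V \<subseteq> (\<Union>\<sigma>\<in>\<Sigma>. chart \<sigma>)" using topspace_toric_variety by blast
  fix \<sigma> assume \<sigma>: "\<sigma> \<in> \<Sigma>"
  let ?R = "chart_ring \<sigma>"
  have "local_ring ?R p \<in> ?V \<longleftrightarrow> f / h \<sigma> \<in> local_ring ?R p" if "p \<in> Spec ?R" for p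
  proof -
    have x: "local_ring ?R p \<in> chart \<sigma>" using that by (simp add: chart_def)
    moreover from this have "local_ring ?R p \<in> topspace (toric_variety \<Sigma>)"
      using \<sigma> topspace_toric_variety by blast
    ultimately show ?thesis using local_equations_change[OF h \<sigma> x] \<sigma> by blast
  qed
  then have "{p \<in> Spec ?R. local_ring ?R p \<in> ?V} = {p \<in> Spec ?R. f / h \<sigma> \<in> local_ring ?R p}"
    by blast
  then show "zariski_open ?R {p \<in> Spec ?R. local_ring ?R p \<in> ?V}"
    using zariski_open_regular_locus[of \<sigma> "f / h \<sigma>"] by simp
qed

section \<open>Module operations, restriction and comparison of sections\<close>

lemma div_sheaf_zero: "0 \<in> div_sheaf \<Sigma> h V"
  using local_ring_zero by (auto simp: div_sheaf_def)

lemma div_sheaf_add: "f \<in> div_sheaf \<Sigma> h V \<Longrightarrow> g \<in> div_sheaf \<Sigma> h V \<Longrightarrow> f + g \<in> div_sheaf \<Sigma> h V"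
  by (simp add: div_sheaf_def add_divide_distrib) (blast intro: local_ring_add)

lemma div_sheaf_uminus: "f \<in> div_sheaf \<Sigma> h V \<Longrightarrow> - f \<in> div_sheaf \<Sigma> h V"
  by (simp add: div_sheaf_def) (blast intro: local_ring_uminus)

lemma div_sheaf_diff: "f \<in> div_sheaf \<Sigma> h V \<Longrightarrow> g \<in> div_sheaf \<Sigma> h V \<Longrightarrow> f - g \<in> div_sheaf \<Sigma> h V"
  using div_sheaf_add[OF _ div_sheaf_uminus, of f \<Sigma> h V g] by simp

lemma div_sheaf_sum: "(\<And>i. i \<in> I \<Longrightarrow> f i \<in> div_sheaf \<Sigma> h V) \<Longrightarrow> sum f I \<in> div_sheaf \<Sigma> h V"
  by (induction I rule: infinite_finite_induct) (auto simp: div_sheaf_zero div_sheaf_add)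

lemma div_sheaf_restrict: "f \<in> div_sheaf \<Sigma> h V \<Longrightarrow> W \<subseteq> V \<Longrightarrow> W \<noteq> {} \<Longrightarrow> f \<in> div_sheaf \<Sigma> h W"
  unfolding div_sheaf_def by blast

lemma div_sheafI:
  assumes "local_equations \<Sigma> h" "V \<noteq> {}"
    and "\<And>x. x \<in> V \<Longrightarrow> \<exists>\<sigma>\<in>\<Sigma>. x \<in> chart \<sigma> \<and> f / h \<sigma> \<in> x"
  shows "f \<in> div_sheaf \<Sigma> h V"
  unfolding div_sheaf_def using assms local_equations_change by blast

lemma div_sheaf_mono:
  assumes h: "local_equations \<Sigma> h"
    and le: "\<And>\<sigma> x. \<sigma> \<in> \<Sigma> \<Longrightarrow> x \<in> chart \<sigma> \<Longrightarrow> h \<sigma> / g \<sigma> \<in> x"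
  shows "div_sheaf \<Sigma> h V \<subseteq> div_sheaf \<Sigma> g V"
proof
  fix f assume f: "f \<in> div_sheaf \<Sigma> h V"
  have "f / g \<sigma> \<in> x" if "\<sigma> \<in> \<Sigma>" "x \<in> V \<inter> chart \<sigma>" for \<sigma> x
  proof -
    have "(f / h \<sigma>) * (h \<sigma> / g \<sigma>) \<in> x"
      using f le[of \<sigma> x] local_ring_mult[of x \<sigma>] that unfolding div_sheaf_def by blast
    then show ?thesis using local_equations_nonzero[OF h that(1)] by simp
  qed
  then show "f \<in> div_sheaf \<Sigma> g V" using f unfolding div_sheaf_def by blast
qed

text \<open>The module is free of rank one over the chart ring: its exponents are those of the ring
  shifted by \<open>m\<close>. Division by the character therefore identifies the two
  localizations.\<close>

lemma localize_monom:
  assumes P: "real_pt m \<in> P" "\<And>w. w \<in> P \<Longrightarrow> w - real_pt m \<in> dual_cone \<sigma>"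
  shows "f \<in> localize (chart_ring \<sigma>) p (laurent_span {m. real_pt m \<in> P + dual_cone \<sigma>})
    \<longleftrightarrow> f / monom_fun m \<in> local_ring (chart_ring \<sigma>) p"
proof -
  let ?R = "chart_ring \<sigma>" let ?N = "laurent_span {m. real_pt m \<in> P + dual_cone \<sigma>}"
  have "real_pt a \<in> P + dual_cone \<sigma> \<longleftrightarrow> real_pt (a - m) \<in> dual_cone \<sigma>" for a
    using plus_dual_cone_iff[OF P] by (simp add: real_pt_minus)
  then have N: "{a. real_pt a \<in> P + dual_cone \<sigma>} = {a. real_pt (a - m) \<in> dual_cone \<sigma>}" by blast
  have "g * monom_fun m \<in> ?N" if "g \<in> carrier ?R" for g
    using that monom_fun_in_laurent_span[of m "{m}"] unfolding N carrier_chart_ring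
    by (rule laurent_span_mult) auto
  moreover have "g / monom_fun m \<in> carrier ?R" if "g \<in> ?N" for g
  proof -
    have "g * monom_fun (- m) \<in> carrier ?R"
      using that monom_fun_in_laurent_span[of "- m" "{- m}"] unfolding N carrier_chart_ring
      by (rule laurent_span_mult) auto
    then show ?thesis using monom_fun_diff[of 0 m] by (simp add: divide_inverse)
  qed
  ultimately show ?thesis
  proof (intro iffI)
    assume N': "\<And>g. g \<in> ?N \<Longrightarrow> g / monom_fun m \<in> carrier ?R"
    assume "f \<in> localize ?R p ?N"
    then obtain g b where gb: "f = g / b" "g \<in> ?N" "b \<in> carrier ?R" "b \<notin> p"
      unfolding localize_def by blast
    then have "f / monom_fun m = (g / monom_fun m) / b" by simp
    then show "f / monom_fun m \<in> local_ring ?R p"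
      unfolding local_ring_def localize_def using N' gb by blast
  next
    assume N': "\<And>g. g \<in> carrier ?R \<Longrightarrow> g * monom_fun m \<in> ?N"
    assume "f / monom_fun m \<in> local_ring ?R p"
    then obtain g b where gb: "f / monom_fun m = g / b" "g \<in> carrier ?R" "b \<in> carrier ?R" "b \<notin> p"
      unfolding local_ring_def localize_def by blast
    have "f = (f / monom_fun m) * monom_fun m" by simp
    then have "f = (g * monom_fun m) / b" unfolding gb(1) by simp
    then show "f \<in> localize ?R p ?N"
      unfolding localize_def using N' gb by blast
  qed
qed

lemma line_sheaf_eq_div_sheaf:
  assumes "\<And>\<sigma>. \<sigma> \<in> \<Sigma> \<Longrightarrow> real_pt (m \<sigma>) \<in> P"
    and "\<And>\<sigma> w. \<sigma> \<in> \<Sigma> \<Longrightarrow> w \<in> P \<Longrightarrow> w - real_pt (m \<sigma>) \<in> dual_cone \<sigma>"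
  shows "line_sheaf \<Sigma> P = div_sheaf \<Sigma> (\<lambda>\<sigma>. monom_fun (m \<sigma>))"
proof
  fix V
  have "f \<in> line_sheaf \<Sigma> P V \<longleftrightarrow> f \<in> div_sheaf \<Sigma> (\<lambda>\<sigma>. monom_fun (m \<sigma>)) V" for f
    unfolding line_sheaf_def div_sheaf_def chart_def
    using localize_monom[OF assms] by auto
  then show "line_sheaf \<Sigma> P V = div_sheaf \<Sigma> (\<lambda>\<sigma>. monom_fun (m \<sigma>)) V" by blast
qed

lemma local_equations_monom:
  assumes "\<And>\<sigma>. \<sigma> \<in> \<Sigma> \<Longrightarrow> real_pt (m \<sigma>) \<in> P"
    and "\<And>\<sigma> w. \<sigma> \<in> \<Sigma> \<Longrightarrow> w \<in> P \<Longrightarrow> w - real_pt (m \<sigma>) \<in> dual_cone \<sigma>"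
  shows "local_equations \<Sigma> (\<lambda>\<sigma>. monom_fun (m \<sigma>))"
  unfolding local_equations_def
proof (intro conjI ballI)
  fix \<sigma> \<tau> x assume "\<sigma> \<in> \<Sigma>" "\<tau> \<in> \<Sigma>" "x \<in> chart \<sigma> \<inter> chart \<tau>"
  then show "monom_fun (m \<sigma>) / monom_fun (m \<tau>) \<in> x"
    using assms by (intro monom_quotient_in_local_ring[where \<sigma> = \<tau>]) auto
qed simp

text \<open>An element of the inverse is tested against the local equation \<open>h \<sigma>\<close>
  itself. That equation need not be a section over \<open>V\<close>, but it is one over a
  neighbourhood \<open>W\<close> of the given point, and the inverse is defined by conditions on all
  open subsets.\<close>

lemma inv_sheaf_div_sheaf:
  assumes h: "local_equations \<Sigma> h" and V: "openin (toric_variety \<Sigma>) V"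
  shows "inv_sheaf \<Sigma> (div_sheaf \<Sigma> h) V = div_sheaf \<Sigma> (\<lambda>\<sigma>. inverse (h \<sigma>)) V"
proof (intro Set.set_eqI iffI)
  fix f assume f: "f \<in> inv_sheaf \<Sigma> (div_sheaf \<Sigma> h) V"
  have "f * h \<sigma> \<in> x" if \<sigma>: "\<sigma> \<in> \<Sigma>" and x: "x \<in> V \<inter> chart \<sigma>" for \<sigma> x
  proof -
    define W where "W = V \<inter>
      {y \<in> topspace (toric_variety \<Sigma>). \<forall>\<tau>\<in>\<Sigma>. y \<in> chart \<tau> \<longrightarrow> h \<sigma> / h \<tau> \<in> y}"
    have W: "openin (toric_variety \<Sigma>) W" "W \<subseteq> V"
      unfolding W_def using V openin_local_sections[OF h] by auto
    have xW: "x \<in> W"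
      using x \<sigma> local_equations_quotient[OF h] openin_subset[OF V] unfolding W_def by blast
    then have "h \<sigma> \<in> div_sheaf \<Sigma> h W" unfolding div_sheaf_def W_def by blast
    then have "f * h \<sigma> \<in> struct_sheaf W" using f W unfolding inv_sheaf_def by blast
    then show ?thesis using xW unfolding struct_sheaf_def by blast
  qed
  then show "f \<in> div_sheaf \<Sigma> (\<lambda>\<sigma>. inverse (h \<sigma>)) V"
    using f by (simp add: div_sheaf_def inv_sheaf_def divide_inverse)
next
  fix f assume f: "f \<in> div_sheaf \<Sigma> (\<lambda>\<sigma>. inverse (h \<sigma>)) V"
  have "f * g \<in> struct_sheaf W"
    if W: "openin (toric_variety \<Sigma>) W" "W \<subseteq> V" and g: "g \<in> div_sheaf \<Sigma> h W" for W g
  proof -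
    have "f * g \<in> x" if x: "x \<in> W" for x
    proof -
      obtain \<sigma> where \<sigma>: "\<sigma> \<in> \<Sigma>" "x \<in> chart \<sigma>" using openin_chartE W(1) x by blast
      have "f / inverse (h \<sigma>) \<in> x" "g / h \<sigma> \<in> x"
        using f g \<sigma> x W(2) unfolding div_sheaf_def by blast+
      then have "(f / inverse (h \<sigma>)) * (g / h \<sigma>) \<in> x" by (rule local_ring_mult[OF \<sigma>(2)])
      moreover have "(f / inverse (h \<sigma>)) * (g / h \<sigma>) = f * g"
        using local_equations_nonzero[OF h \<sigma>(1)] by simp
      ultimately show ?thesis by (simp only:)
    qed
    then show ?thesis using g by (simp add: struct_sheaf_def div_sheaf_def)
  qed
  then show "f \<in> inv_sheaf \<Sigma> (div_sheaf \<Sigma> h) V"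
    using f unfolding inv_sheaf_def div_sheaf_def by blast
qed

text \<open>Formulated through the stalks \<open>St \<sigma> x\<close> of \<open>F\<close> in order to cover line bundles and direct sums alike.\<close>

lemma tensor_sheaf_inv_div_sheaf:
  fixes sc :: "'d::{finite,linorder} ratfun \<Rightarrow> 'a::ab_group_add \<Rightarrow> 'a"
    and St :: "'d rvec set \<Rightarrow> 'd ratfun set \<Rightarrow> 'a set"
  assumes h: "local_equations \<Sigma> h"
    and F: "\<And>W. openin (toric_variety \<Sigma>) W \<Longrightarrow> W \<noteq> {} \<Longrightarrow>
      F W = {a. \<forall>\<sigma>\<in>\<Sigma>. \<forall>x\<in>W \<inter> chart \<sigma>. a \<in> St \<sigma> x}"
    and zero: "\<And>\<sigma> x. x \<in> chart \<sigma> \<Longrightarrow> 0 \<in> St \<sigma> x"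
    and add: "\<And>\<sigma> x a b. x \<in> chart \<sigma> \<Longrightarrow> a \<in> St \<sigma> x \<Longrightarrow> b \<in> St \<sigma> x \<Longrightarrow> a + b \<in> St \<sigma> x"
    and smult: "\<And>\<sigma> x r a. x \<in> chart \<sigma> \<Longrightarrow> r \<in> x \<Longrightarrow> a \<in> St \<sigma> x \<Longrightarrow> sc r a \<in> St \<sigma> x"
    and op: "\<And>a. openin (toric_variety \<Sigma>)
      {x \<in> topspace (toric_variety \<Sigma>). \<forall>\<sigma>\<in>\<Sigma>. x \<in> chart \<sigma> \<longrightarrow> a \<in> St \<sigma> x}"
    and change: "\<And>\<sigma> \<tau> x a. \<sigma> \<in> \<Sigma> \<Longrightarrow> \<tau> \<in> \<Sigma> \<Longrightarrow> x \<in> chart \<sigma> \<Longrightarrow> x \<in> chart \<tau> \<Longrightarrow>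
      a \<in> St \<sigma> x \<Longrightarrow> a \<in> St \<tau> x"
    and sc: "\<And>r a b. sc r (a + b) = sc r a + sc r b" "\<And>r. sc r 0 = 0"
      "\<And>r s a. sc r (sc s a) = sc (r * s) a" "\<And>a. sc 1 a = a"
    and V: "V \<subseteq> topspace (toric_variety \<Sigma>)"
  shows "tensor_sheaf \<Sigma> sc F (inv_sheaf \<Sigma> (div_sheaf \<Sigma> h)) V =
    {f. (V = {} \<longrightarrow> f = 0) \<and> (\<forall>\<sigma>\<in>\<Sigma>. \<forall>x\<in>V \<inter> chart \<sigma>. sc (h \<sigma>) f \<in> St \<sigma> x)}"
proof (intro Set.set_eqI iffI)
  have sc_sum: "sc r (sum a I) = (\<Sum>l\<in>I. sc r (a l))" for r and a :: "nat \<Rightarrow> 'a" and I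
    by (induction I rule: infinite_finite_induct) (simp_all add: sc)
  have St_sum: "sum a I \<in> St \<sigma> x" if "x \<in> chart \<sigma>" "\<And>l. l \<in> I \<Longrightarrow> a l \<in> St \<sigma> x"
    for \<sigma> x I and a :: "nat \<Rightarrow> 'a"
    using that(2) by (induction I rule: infinite_finite_induct) (simp_all add: zero add that(1))
  fix f assume f: "f \<in> tensor_sheaf \<Sigma> sc F (inv_sheaf \<Sigma> (div_sheaf \<Sigma> h)) V"
  have "sc (h \<sigma>) f \<in> St \<sigma> x" if \<sigma>: "\<sigma> \<in> \<Sigma>" and x: "x \<in> V \<inter> chart \<sigma>" for \<sigma> x
  proof -
    obtain W and N :: nat and a b where W: "openin (toric_variety \<Sigma>) W" "x \<in> W"
      and a: "\<And>l. l < N \<Longrightarrow> a l \<in> F W"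
      and b: "\<And>l. l < N \<Longrightarrow> b l \<in> inv_sheaf \<Sigma> (div_sheaf \<Sigma> h) W"
      and sum: "f = (\<Sum>l<N. sc (b l) (a l))"
      using f x unfolding tensor_sheaf_def by blast
    have "sc (h \<sigma>) (sc (b l) (a l)) \<in> St \<sigma> x" if l: "l < N" for l
    proof -
      have "b l / inverse (h \<sigma>) \<in> x"
        using b[OF l] W(2) \<sigma> x unfolding inv_sheaf_div_sheaf[OF h W(1)] div_sheaf_def by blast
      then have "h \<sigma> * b l \<in> x" by (simp add: divide_inverse mult.commute)
      moreover have "a l \<in> St \<sigma> x" using a[OF l] F[OF W(1)] W(2) \<sigma> x by blast
      ultimately show ?thesis using smult x by (simp add: sc)
    qed
    then show ?thesis unfolding sum sc_sum using x by (intro St_sum) auto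
  qed
  then show "f \<in> {f. (V = {} \<longrightarrow> f = 0) \<and> (\<forall>\<sigma>\<in>\<Sigma>. \<forall>x\<in>V \<inter> chart \<sigma>. sc (h \<sigma>) f \<in> St \<sigma> x)}"
    using f by (simp add: tensor_sheaf_def)
next
  fix f assume "f \<in> {f. (V = {} \<longrightarrow> f = 0) \<and> (\<forall>\<sigma>\<in>\<Sigma>. \<forall>x\<in>V \<inter> chart \<sigma>. sc (h \<sigma>) f \<in> St \<sigma> x)}"
  then have f0: "V = {} \<longrightarrow> f = 0"
    and f: "\<And>\<sigma> x. \<sigma> \<in> \<Sigma> \<Longrightarrow> x \<in> V \<inter> chart \<sigma> \<Longrightarrow> sc (h \<sigma>) f \<in> St \<sigma> x" by auto
  have local: "\<exists>W. openin (toric_variety \<Sigma>) W \<and> x \<in> W \<and> (\<exists>N::nat. \<exists>a b.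
      (\<forall>l<N. a l \<in> F W \<and> b l \<in> inv_sheaf \<Sigma> (div_sheaf \<Sigma> h) W) \<and> f = (\<Sum>l<N. sc (b l) (a l)))"
    if x: "x \<in> V" for x
  proof -
    obtain \<sigma> where \<sigma>: "\<sigma> \<in> \<Sigma>" "x \<in> chart \<sigma>" using V x topspace_toric_variety by blast
    note h' = local_equations_inverse[OF h]
    \<comment> \<open>One summand suffices locally: \<open>f\<close> is the inverse equation times
      \<open>h \<sigma>\<close> times \<open>f\<close>, and \<open>W\<close> is the open set where
      both factors are sections.\<close>
    define b where "b = inverse (h \<sigma>)"
    define a where "a = sc (h \<sigma>) f"
    define W where "W = {y \<in> topspace (toric_variety \<Sigma>). \<forall>\<tau>\<in>\<Sigma>. y \<in> chart \<tau> \<longrightarrow> a \<in> St \<tau> y} \<inter>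
      {y \<in> topspace (toric_variety \<Sigma>). \<forall>\<tau>\<in>\<Sigma>. y \<in> chart \<tau> \<longrightarrow> b / inverse (h \<tau>) \<in> y}"
    have W: "openin (toric_variety \<Sigma>) W"
      unfolding W_def using op openin_local_sections[OF h'] by (intro openin_Int) auto
    have "a \<in> St \<tau> x" if "\<tau> \<in> \<Sigma>" "x \<in> chart \<tau>" for \<tau>
      using change[OF \<sigma>(1) that(1) \<sigma>(2) that(2)] f \<sigma> x unfolding a_def by blast
    moreover have "b / inverse (h \<tau>) \<in> x" if "\<tau> \<in> \<Sigma>" "x \<in> chart \<tau>" for \<tau>
      using local_equations_quotient[OF h'] \<sigma> that unfolding b_def by blast
    ultimately have xW: "x \<in> W" unfolding W_def using V x by blast
    then have "a \<in> F W" using F[OF W] unfolding W_def by blast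
    moreover have "b \<in> inv_sheaf \<Sigma> (div_sheaf \<Sigma> h) W"
      unfolding inv_sheaf_div_sheaf[OF h W] div_sheaf_def using xW unfolding W_def by blast
    moreover have "f = sc b a"
      unfolding a_def b_def sc using local_equations_nonzero[OF h \<sigma>(1)] by (simp add: sc)
    ultimately show ?thesis
      using W xW by (intro exI[of _ W] conjI exI[of _ "1::nat"] exI[of _ "\<lambda>_. a"] exI[of _ "\<lambda>_. b"]) auto
  qed
  then show "f \<in> tensor_sheaf \<Sigma> sc F (inv_sheaf \<Sigma> (div_sheaf \<Sigma> h)) V"
    unfolding tensor_sheaf_def by (intro CollectI conjI ballI f0 local)
qed

lemma tensor_sheaf_line:
  assumes h: "local_equations \<Sigma> h" and g: "local_equations \<Sigma> g"
    and V: "V \<subseteq> topspace (toric_variety \<Sigma>)"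
  shows "tensor_sheaf \<Sigma> (*) (div_sheaf \<Sigma> g) (inv_sheaf \<Sigma> (div_sheaf \<Sigma> h)) V =
    div_sheaf \<Sigma> (\<lambda>\<sigma>. g \<sigma> / h \<sigma>) V"
proof -
  have "tensor_sheaf \<Sigma> (*) (div_sheaf \<Sigma> g) (inv_sheaf \<Sigma> (div_sheaf \<Sigma> h)) V =
    {f. (V = {} \<longrightarrow> f = 0) \<and> (\<forall>\<sigma>\<in>\<Sigma>. \<forall>x\<in>V \<inter> chart \<sigma>. h \<sigma> * f \<in> {a. a / g \<sigma> \<in> x})}"
  proof (rule tensor_sheaf_inv_div_sheaf[OF h _ _ _ _ _ _ _ _ _ _ V])
    show "div_sheaf \<Sigma> g W = {a. \<forall>\<sigma>\<in>\<Sigma>. \<forall>x\<in>W \<inter> chart \<sigma>. a \<in> {a. a / g \<sigma> \<in> x}}" if "W \<noteq> {}" for W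
      using that unfolding div_sheaf_def by blast
    show "r * a \<in> {a. a / g \<sigma> \<in> x}" if "x \<in> chart \<sigma>" "r \<in> x" "a \<in> {a. a / g \<sigma> \<in> x}" for \<sigma> x r a
      using local_ring_mult[OF that(1,2), of "a / g \<sigma>"] that(3) by simp
    show "openin (toric_variety \<Sigma>) {x \<in> topspace (toric_variety \<Sigma>).
        \<forall>\<sigma>\<in>\<Sigma>. x \<in> chart \<sigma> \<longrightarrow> a \<in> {a. a / g \<sigma> \<in> x}}" for a
      using openin_local_sections[OF g, of a] by simp
    show "a \<in> {a. a / g \<tau> \<in> x}" if "\<sigma> \<in> \<Sigma>" "\<tau> \<in> \<Sigma>" "x \<in> chart \<sigma>" "x \<in> chart \<tau>" "a \<in> {a. a / g \<sigma> \<in> x}"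
      for \<sigma> \<tau> x a
      using local_equations_change[OF g] that by blast
  qed (auto simp: local_ring_zero local_ring_add add_divide_distrib algebra_simps)
  then show ?thesis unfolding div_sheaf_def by (simp add: mult.commute)
qed

lemma direct_sum_cong: "(\<And>i. i \<in> I \<Longrightarrow> F i = G i) \<Longrightarrow> direct_sum I F = direct_sum I G"
  unfolding direct_sum_def by auto

lemma tensor_sheaf_direct_sum:
  fixes h :: "'d rvec set \<Rightarrow> 'd::{finite,linorder} ratfun"
  assumes h: "local_equations \<Sigma> h" and g: "\<And>i. i \<in> I \<Longrightarrow> local_equations \<Sigma> (g i)"
    and V: "V \<subseteq> topspace (toric_variety \<Sigma>)" and I: "finite I"
  shows "tensor_sheaf \<Sigma> vscale (direct_sum I (\<lambda>i. div_sheaf \<Sigma> (g i))) (inv_sheaf \<Sigma> (div_sheaf \<Sigma> h)) V =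
    direct_sum I (\<lambda>i. div_sheaf \<Sigma> (\<lambda>\<sigma>. g i \<sigma> / h \<sigma>)) V"
proof -
  let ?St = "\<lambda>\<sigma> x. {s. (\<forall>i\<in>I. s i / g i \<sigma> \<in> x) \<and> (\<forall>i. i \<notin> I \<longrightarrow> s i = 0)}"
  have "tensor_sheaf \<Sigma> vscale (direct_sum I (\<lambda>i. div_sheaf \<Sigma> (g i))) (inv_sheaf \<Sigma> (div_sheaf \<Sigma> h)) V =
    {f. (V = {} \<longrightarrow> f = 0) \<and> (\<forall>\<sigma>\<in>\<Sigma>. \<forall>x\<in>V \<inter> chart \<sigma>. vscale (h \<sigma>) f \<in> ?St \<sigma> x)}"
  proof (rule tensor_sheaf_inv_div_sheaf[OF h _ _ _ _ _ _ _ _ _ _ V])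
    show "direct_sum I (\<lambda>i. div_sheaf \<Sigma> (g i)) W = {a. \<forall>\<sigma>\<in>\<Sigma>. \<forall>x\<in>W \<inter> chart \<sigma>. a \<in> ?St \<sigma> x}"
      if W: "openin (toric_variety \<Sigma>) W" "W \<noteq> {}" for W
    proof -
      obtain x \<sigma> where "x \<in> W" "\<sigma> \<in> \<Sigma>" "x \<in> chart \<sigma>" using W openin_chartE by (metis ex_in_conv)
      then show ?thesis unfolding direct_sum_def div_sheaf_def by blast
    qed
    show "vscale r a \<in> ?St \<sigma> x" if "x \<in> chart \<sigma>" "r \<in> x" "a \<in> ?St \<sigma> x" for \<sigma> x r a
      using local_ring_mult[OF that(1,2)] that(3) by (force simp: vscale_def simp flip: times_divide_eq_right)
    show "openin (toric_variety \<Sigma>) {x \<in> topspace (toric_variety \<Sigma>).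
        \<forall>\<sigma>\<in>\<Sigma>. x \<in> chart \<sigma> \<longrightarrow> a \<in> ?St \<sigma> x}" (is "openin _ ?W") for a
    proof (cases "\<forall>i. i \<notin> I \<longrightarrow> a i = 0")
      case True
      \<comment> \<open>The intersection with \<open>topspace\<close> accounts for empty
        \<open>I\<close>, where the indexed intersection is the whole type.\<close>
      then have "?W = (\<Inter>i\<in>I. {x \<in> topspace (toric_variety \<Sigma>).
          \<forall>\<sigma>\<in>\<Sigma>. x \<in> chart \<sigma> \<longrightarrow> a i / g i \<sigma> \<in> x}) \<inter> topspace (toric_variety \<Sigma>)" by auto
      then show ?thesis
        using openin_INT[OF I openin_local_sections[OF g]] by simp
    next
      case False
      then have "?W = {}" using topspace_toric_variety by blast
      then show ?thesis by (metis openin_empty)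
    qed
    show "a \<in> ?St \<tau> x" if "\<sigma> \<in> \<Sigma>" "\<tau> \<in> \<Sigma>" "x \<in> chart \<sigma>" "x \<in> chart \<tau>" "a \<in> ?St \<sigma> x" for \<sigma> \<tau> x a
      using local_equations_change[OF g that(1,3,2,4)] that(5) by blast
  qed (auto simp: local_ring_zero local_ring_add add_divide_distrib algebra_simps vscale_def)
  also have "\<dots> = direct_sum I (\<lambda>i. div_sheaf \<Sigma> (\<lambda>\<sigma>. g i \<sigma> / h \<sigma>)) V" (is "?L = ?R")
  proof (cases "V = {}")
    case True
    then show ?thesis unfolding direct_sum_def div_sheaf_def by (auto simp: zero_fun_def)
  next
    case False
    \<comment> \<open>On the left, vanishing outside \<open>I\<close> is imposed only through stalks
      and after multiplication by \<open>h \<sigma>\<close>. A point of \<open>V\<close> and a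
      nonzero equation there are needed to recover it for \<open>f\<close>.\<close>
    then obtain x \<sigma> where x: "x \<in> V" "\<sigma> \<in> \<Sigma>" "x \<in> chart \<sigma>" using V topspace_toric_variety by blast
    then have hz: "h \<sigma> \<noteq> 0" using local_equations_nonzero[OF h] by blast
    show ?thesis
    proof (intro Set.set_eqI iffI)
      fix f assume f: "f \<in> ?L"
      then have "\<forall>i. i \<notin> I \<longrightarrow> h \<sigma> * f i = 0" using x unfolding vscale_def by blast
      then have "\<forall>i. i \<notin> I \<longrightarrow> f i = 0" using hz by simp
      then show "f \<in> ?R" using f False by (simp add: direct_sum_def div_sheaf_def vscale_def mult.commute)
    next
      fix f assume "f \<in> ?R"
      then show "f \<in> ?L" using False by (simp add: direct_sum_def div_sheaf_def vscale_def mult.commute)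
    qed
  qed
  finally show ?thesis .
qed

section \<open>Cech cocycles\<close>

lemma cech_Z1D:
  assumes "z \<in> cech_Z1 k U F"
  shows cech_Z1_section: "1 \<le> i \<Longrightarrow> i < j \<Longrightarrow> j \<le> k \<Longrightarrow> z i j \<in> F (U i \<inter> U j)"
    and cech_Z1_outside: "\<not> (1 \<le> i \<and> i < j \<and> j \<le> k) \<Longrightarrow> z i j = 0"
    and cech_Z1_cocycle: "1 \<le> i \<Longrightarrow> i < j \<Longrightarrow> j < l \<Longrightarrow> l \<le> k \<Longrightarrow> z j l - z i l + z i j = 0"
proof -
  note D = CollectD[OF assms[unfolded cech_Z1_def]]
  note if_D = conjunct1[OF D, THEN spec, THEN spec, of i j]
  show "1 \<le> i \<Longrightarrow> i < j \<Longrightarrow> j \<le> k \<Longrightarrow> z i j \<in> F (U i \<inter> U j)"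
    using if_D by (simp only: simp_thms if_True)
  show "\<not> (1 \<le> i \<and> i < j \<and> j \<le> k) \<Longrightarrow> z i j = 0"
    using if_D by (simp only: simp_thms if_False)
  show "1 \<le> i \<Longrightarrow> i < j \<Longrightarrow> j < l \<Longrightarrow> l \<le> k \<Longrightarrow> z j l - z i l + z i j = 0"
    by (rule conjunct2[OF D, THEN spec, THEN spec, THEN spec, THEN mp]) (intro conjI)
qed

lemma cech_Z1I:
  assumes "\<And>i j. 1 \<le> i \<Longrightarrow> i < j \<Longrightarrow> j \<le> k \<Longrightarrow> z i j \<in> F (U i \<inter> U j)"
    and "\<And>i j. \<not> (1 \<le> i \<and> i < j \<and> j \<le> k) \<Longrightarrow> z i j = 0"
    and "\<And>i j l. 1 \<le> i \<Longrightarrow> i < j \<Longrightarrow> j < l \<Longrightarrow> l \<le> k \<Longrightarrow> z j l - z i l + z i j = 0"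
  shows "z \<in> cech_Z1 k U F"
  unfolding cech_Z1_def using assms by simp

text \<open>Agreement is asked only on overlaps of the covering, because tensor products are
  identified with sheaves of local equations only over subsets of the variety.\<close>

lemma cech_Z1_cong:
  assumes "\<And>i j. i \<in> {1..k} \<Longrightarrow> j \<in> {1..k} \<Longrightarrow> F (U i \<inter> U j) = F' (U i \<inter> U j)"
  shows "cech_Z1 k U F = cech_Z1 k U F'"
proof -
  have "(if 1 \<le> i \<and> i < j \<and> j \<le> k then z i j \<in> F (U i \<inter> U j) else z i j = 0)
    = (if 1 \<le> i \<and> i < j \<and> j \<le> k then z i j \<in> F' (U i \<inter> U j) else z i j = 0)" for z i j
    using assms[of i j] by auto
  then show ?thesis unfolding cech_Z1_def by (simp only:)
qed

lemma cech_rel_cong: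
  assumes F: "\<And>i j. i \<in> {1..k} \<Longrightarrow> j \<in> {1..k} \<Longrightarrow> F (U i \<inter> U j) = F' (U i \<inter> U j)"
  shows "cech_rel k U F = cech_rel k U F'"
proof -
  have Z1: "cech_Z1 k U F = cech_Z1 k U F'" by (rule cech_Z1_cong) (rule F)
  \<comment> \<open>The case of equal indices in \<open>F\<close> gives agreement on the members of
    the covering themselves.\<close>
  have "(\<forall>i\<in>{1..k}. s i \<in> F (U i)) = (\<forall>i\<in>{1..k}. s i \<in> F' (U i))" for s
    using F[of i i for i] by simp
  then show ?thesis unfolding cech_rel_def Z1 by (simp only:)
qed

lemma connectingE:
  assumes "z \<in> connecting k U F \<alpha> E \<beta> g"
  obtains e where "z \<in> cech_Z1 k U F" "\<forall>i\<in>{1..k}. e i \<in> E (U i) \<and> \<beta> (e i) = g"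
    "\<forall>i j. 1 \<le> i \<and> i < j \<and> j \<le> k \<longrightarrow> \<alpha> (z i j) = e j - e i"
  using CollectD[OF assms[unfolded connecting_def]] by (elim conjE exE) (rule that)

lemma connecting_cong:
  assumes F: "\<And>i j. i \<in> {1..k} \<Longrightarrow> j \<in> {1..k} \<Longrightarrow> F (U i \<inter> U j) = F' (U i \<inter> U j)"
    and E: "\<And>i. i \<in> {1..k} \<Longrightarrow> E (U i) = E' (U i)"
  shows "connecting k U F \<alpha> E \<beta> g = connecting k U F' \<alpha> E' \<beta> g"
proof -
  have Z1: "cech_Z1 k U F = cech_Z1 k U F'" by (rule cech_Z1_cong) (rule F)
  have "(\<forall>i\<in>{1..k}. e i \<in> E (U i) \<and> \<beta> (e i) = g) = (\<forall>i\<in>{1..k}. e i \<in> E' (U i) \<and> \<beta> (e i) = g)" for e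
    using E by simp
  then show ?thesis unfolding connecting_def Z1 by (simp only:)
qed

lemma cech_diff_in_Z1:
  assumes "\<And>i j. 1 \<le> i \<Longrightarrow> i < j \<Longrightarrow> j \<le> k \<Longrightarrow> s j - s i \<in> F (U i \<inter> U j)"
  shows "cech_diff k s \<in> cech_Z1 k U F"
  using assms by (intro cech_Z1I) (auto simp: cech_diff_def)

lemma cech_Z1_add:
  assumes "z \<in> cech_Z1 k U F" "w \<in> cech_Z1 k U F"
    and "\<And>V f g. f \<in> F V \<Longrightarrow> g \<in> F V \<Longrightarrow> f + g \<in> F V"
  shows "z + w \<in> cech_Z1 k U F"
proof (rule cech_Z1I)
  fix i j l assume ijl: "1 \<le> i" "i < j" "j < l" "l \<le> k"
  have "(z + w) j l - (z + w) i l + (z + w) i j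
      = (z j l - z i l + z i j) + (w j l - w i l + w i j)" by simp
  then show "(z + w) j l - (z + w) i l + (z + w) i j = 0"
    using cech_Z1_cocycle[OF assms(1) ijl] cech_Z1_cocycle[OF assms(2) ijl] by simp
next
  fix i j assume "1 \<le> i" "i < j" "j \<le> k"
  then show "(z + w) i j \<in> F (U i \<inter> U j)"
    using assms by (simp add: cech_Z1_section)
next
  fix i j assume "\<not> (1 \<le> i \<and> i < j \<and> j \<le> k)"
  then show "(z + w) i j = 0"
    using cech_Z1_outside[OF assms(1)] cech_Z1_outside[OF assms(2)] by simp
qed

lemma cech_relI:
  assumes "z \<in> cech_Z1 k U F" "w \<in> cech_Z1 k U F"
    and "\<And>i. i \<in> {1..k} \<Longrightarrow> s i \<in> F (U i)" "w - z = cech_diff k s"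
  shows "w \<in> cech_rel k U F `` {z}"
  unfolding cech_rel_def Image_singleton_iff mem_Collect_eq prod.case
  by (intro conjI exI[of _ s] ballI assms)

lemma cech_relE:
  assumes "w \<in> cech_rel k U F `` {z}"
  obtains s where "w \<in> cech_Z1 k U F" "\<forall>i\<in>{1..k}. s i \<in> F (U i)" "w - z = cech_diff k s"
  using assms unfolding cech_rel_def Image_singleton_iff mem_Collect_eq prod.case by metis

text \<open>Composing two relations adds the 0-cochains, and reversing one negates the cochain;
  closure of sections under both operations gives the two inclusions.\<close>

lemma cech_rel_class_eq:
  assumes z: "z \<in> cech_Z1 k U F" and w: "w \<in> cech_Z1 k U F"
    and s: "\<And>i. i \<in> {1..k} \<Longrightarrow> s i \<in> F (U i)" "w - z = cech_diff k s"
    and add: "\<And>V f g. f \<in> F V \<Longrightarrow> g \<in> F V \<Longrightarrow> f + g \<in> F V"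
    and uminus: "\<And>V f. f \<in> F V \<Longrightarrow> - f \<in> F V"
  shows "cech_rel k U F `` {z} = cech_rel k U F `` {w}"
proof -
  have sub: "cech_rel k U F `` {w} \<subseteq> cech_rel k U F `` {z}"
    if z: "z \<in> cech_Z1 k U F" and s: "\<And>i. i \<in> {1..k} \<Longrightarrow> s i \<in> F (U i)" "w - z = cech_diff k s"
    for z w s
  proof
    fix v assume "v \<in> cech_rel k U F `` {w}"
    then obtain t where t: "v \<in> cech_Z1 k U F" "\<forall>i\<in>{1..k}. t i \<in> F (U i)" "v - w = cech_diff k t"
      by (rule cech_relE)
    have "v - z = (v - w) + (w - z)" by simp
    also have "\<dots> = cech_diff k (\<lambda>i. t i + s i)"
      unfolding t(3) s(2) by (auto simp: cech_diff_def fun_eq_iff)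
    finally have "v - z = cech_diff k (\<lambda>i. t i + s i)" .
    then show "v \<in> cech_rel k U F `` {z}"
      by (rule cech_relI[OF z t(1), rotated]) (intro add t(2)[rule_format] s(1))
  qed
  have "z - w = cech_diff k (\<lambda>i. - s i)"
  proof -
    have "z - w = - (w - z)" by simp
    then show ?thesis unfolding s(2) by (auto simp: cech_diff_def fun_eq_iff)
  qed
  then have "cech_rel k U F `` {z} \<subseteq> cech_rel k U F `` {w}"
    by (intro sub[OF w, of "\<lambda>i. - s i"]) (simp_all add: s(1) uminus)
  then show ?thesis using sub[OF z s] by blast
qed


section \<open>The extension in terms of local equations\<close>

lemma ext_sum_ext_incl: "ext_sum n (ext_incl n s) = 0"
proof -
  have "ext_sum n (ext_incl n s) = ext_incl n s 0 + (\<Sum>i=1..n. ext_incl n s i)"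
    unfolding ext_sum_def by (simp add: sum.atLeast_Suc_atMost)
  also have "(\<Sum>i=1..n. ext_incl n s i) = (\<Sum>i=1..n. s i)"
    by (intro sum.cong) (auto simp: ext_incl_def)
  finally show ?thesis by (simp add: ext_incl_def)
qed

text \<open>Vectors of sum 0 are parametrised by their entries 1 to \<open>n\<close>, the entry 0
  being forced by the sum.\<close>

lemma ext_incl_eqI:
  assumes "\<And>i. i \<in> {1..n} \<Longrightarrow> s i = e i" "\<And>i. i > n \<Longrightarrow> e i = 0" "ext_sum n e = 0"
  shows "ext_incl n s = e"
proof
  have "e 0 + (\<Sum>i=1..n. e i) = 0"
    using assms(3) by (simp add: ext_sum_def sum.atLeast_Suc_atMost)
  moreover have "(\<Sum>i=1..n. e i) = (\<Sum>i=1..n. s i)" using assms(1) by simp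
  ultimately have "e 0 = - (\<Sum>i=1..n. s i)" by (simp add: eq_neg_iff_add_eq_0)
  then show "ext_incl n s i = e i" for i
    using assms(1)[of i] assms(2)[of i] by (auto simp: ext_incl_def)
qed

lemma ext_incl_div_sheaf:
  assumes s: "s \<in> direct_sum {1..n} (\<lambda>_. div_sheaf \<Sigma> h) V"
    and le: "\<And>i. i \<le> n \<Longrightarrow> div_sheaf \<Sigma> h V \<subseteq> div_sheaf \<Sigma> (g i) V"
  shows "ext_incl n s \<in> direct_sum {0..n} (\<lambda>i. div_sheaf \<Sigma> (g i)) V"
proof -
  have mem: "s j \<in> div_sheaf \<Sigma> (g i) V" if "j \<in> {1..n}" "i \<le> n" for i j
    using s le[OF that(2)] that(1) unfolding direct_sum_def by blast
  show ?thesis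
    unfolding direct_sum_def ext_incl_def using mem
    by (auto intro!: div_sheaf_uminus div_sheaf_sum)
qed

text \<open>
  Local equations \<open>hP\<close>, \<open>hM\<close>, \<open>hD i\<close> of \<open>\<O>(\<Delta>\<^sup>+)\<close>, \<open>\<O>(\<Delta>\<^sup>-)\<close>, \<open>\<O>(\<nabla>\<^sub>i)\<close>. On the chart of \<open>\<sigma>\<close> the sheaf \<open>\<O>(\<nabla>\<^sub>i)\<close>
  is \<open>\<O>(\<Delta>\<^sup>-)\<close> for the one index \<open>i = idx \<sigma>\<close> and \<open>\<O>(\<Delta>\<^sup>+)\<close> for all others.
\<close>

locale local_extension =
  fixes \<Sigma> :: "'d::{finite,linorder} rvec set set"
    and hP hM :: "'d rvec set \<Rightarrow> 'd ratfun" and hD :: "nat \<Rightarrow> 'd rvec set \<Rightarrow> 'd ratfun"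
    and n :: nat and idx :: "'d rvec set \<Rightarrow> nat"
  assumes eqP: "local_equations \<Sigma> hP" and eqM: "local_equations \<Sigma> hM"
    and eqD: "\<And>i. i \<le> n \<Longrightarrow> local_equations \<Sigma> (hD i)"
    and idx: "\<And>\<sigma>. \<sigma> \<in> \<Sigma> \<Longrightarrow> idx \<sigma> \<le> n"
    and P_le_D: "\<And>i \<sigma> x. i \<le> n \<Longrightarrow> \<sigma> \<in> \<Sigma> \<Longrightarrow> x \<in> chart \<sigma> \<Longrightarrow> hP \<sigma> / hD i \<sigma> \<in> x"
    and D_le_M: "\<And>i \<sigma> x. i \<le> n \<Longrightarrow> \<sigma> \<in> \<Sigma> \<Longrightarrow> x \<in> chart \<sigma> \<Longrightarrow> hD i \<sigma> / hM \<sigma> \<in> x"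
    and M_le_idx: "\<And>\<sigma> x. \<sigma> \<in> \<Sigma> \<Longrightarrow> x \<in> chart \<sigma> \<Longrightarrow> hM \<sigma> / hD (idx \<sigma>) \<sigma> \<in> x"
    and D_le_P: "\<And>i \<sigma> x. i \<le> n \<Longrightarrow> i \<noteq> idx \<sigma> \<Longrightarrow> \<sigma> \<in> \<Sigma> \<Longrightarrow> x \<in> chart \<sigma> \<Longrightarrow> hD i \<sigma> / hP \<sigma> \<in> x"
begin

abbreviation "X \<equiv> toric_variety \<Sigma>"
abbreviation "F \<equiv> direct_sum {1..n} (\<lambda>_. div_sheaf \<Sigma> hP)"
abbreviation "E \<equiv> direct_sum {0..n} (\<lambda>i. div_sheaf \<Sigma> (hD i))"
abbreviation "G \<equiv> div_sheaf \<Sigma> hM"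

abbreviation "L \<equiv> div_sheaf \<Sigma> (\<lambda>\<sigma>. hP \<sigma> / hM \<sigma>)"
abbreviation "EM \<equiv> direct_sum {0..n} (\<lambda>i. div_sheaf \<Sigma> (\<lambda>\<sigma>. hD i \<sigma> / hM \<sigma>))"

lemma eqL: "local_equations \<Sigma> (\<lambda>\<sigma>. hP \<sigma> / hM \<sigma>)"
  using local_equations_divide[OF eqP eqM] .

lemma eqEM: "i \<le> n \<Longrightarrow> local_equations \<Sigma> (\<lambda>\<sigma>. hD i \<sigma> / hM \<sigma>)"
  using local_equations_divide[OF eqD eqM] .

text \<open>Away from the index of the chart, \<nabla>_j and \<Delta>^+ have the same stalk, so
  those entries already qualify. The remaining entry is minus their sum.\<close>

lemma local_kernel:
  assumes \<sigma>: "\<sigma> \<in> \<Sigma>" "x \<in> chart \<sigma>"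
    and e: "\<And>i. i \<le> n \<Longrightarrow> e i / hD i \<sigma> \<in> x" and sum: "ext_sum n e = 0" and i: "i \<le> n"
  shows "e i / hP \<sigma> \<in> x"
proof -
  have other: "e j / hP \<sigma> \<in> x" if j: "j \<le> n" "j \<noteq> idx \<sigma>" for j
  proof -
    have "(e j / hD j \<sigma>) * (hD j \<sigma> / hP \<sigma>) \<in> x"
      using local_ring_mult[OF \<sigma>(2) e[OF j(1)] D_le_P[OF j \<sigma>]] .
    then show ?thesis using local_equations_nonzero[OF eqD[OF j(1)] \<sigma>(1)] by simp
  qed
  show ?thesis
  proof (cases "i = idx \<sigma>")
    case True
    have "e i + (\<Sum>j\<in>{0..n} - {i}. e j) = 0"
      using sum i unfolding ext_sum_def by (subst (asm) sum.remove[of _ i]) auto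
    then have "e i / hP \<sigma> = - (\<Sum>j\<in>{0..n} - {i}. e j / hP \<sigma>)"
      by (simp add: eq_neg_iff_add_eq_0 flip: sum_divide_distrib add_divide_distrib)
    moreover have "- (\<Sum>j\<in>{0..n} - {i}. e j / hP \<sigma>) \<in> x"
      using \<sigma>(2) True other by (intro local_ring_uminus local_ring_sum) auto
    ultimately show ?thesis by (simp only:)
  qed (use other i in blast)
qed

section \<open>The morphisms and the exactness of the sequence\<close>

lemma sheaf_hom_ext_incl: "sheaf_hom \<Sigma> vscale vscale F E (ext_incl n)"
  unfolding sheaf_hom_def
proof (intro allI impI conjI ballI)
  fix V s
  assume s: "s \<in> F V"
  show "ext_incl n s \<in> E V"
    using s div_sheaf_mono[OF eqP P_le_D] by (intro ext_incl_div_sheaf) blast+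
next
  fix s t :: "nat \<Rightarrow> 'd ratfun"
  show "ext_incl n (s + t) = ext_incl n s + ext_incl n t"
    by (auto simp: ext_incl_def fun_eq_iff sum.distrib)
next
  fix r and s :: "nat \<Rightarrow> 'd ratfun"
  show "ext_incl n (vscale r s) = vscale r (ext_incl n s)"
    by (auto simp: ext_incl_def vscale_def fun_eq_iff sum_distrib_left)
qed

lemma sheaf_hom_ext_sum: "sheaf_hom \<Sigma> vscale (*) E G (ext_sum n)"
  unfolding sheaf_hom_def
proof (intro allI impI conjI ballI)
  fix V e
  assume e: "e \<in> E V"
  have "e i \<in> G V" if "i \<in> {0..n}" for i
    using e that div_sheaf_mono[OF eqD D_le_M] unfolding direct_sum_def by force
  then show "ext_sum n e \<in> G V" unfolding ext_sum_def by (rule div_sheaf_sum)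
next
  fix s t :: "nat \<Rightarrow> 'd ratfun"
  show "ext_sum n (s + t) = ext_sum n s + ext_sum n t"
    by (simp add: ext_sum_def sum.distrib)
next
  fix r and s :: "nat \<Rightarrow> 'd ratfun"
  show "ext_sum n (vscale r s) = r * ext_sum n s"
    by (simp add: ext_sum_def vscale_def sum_distrib_left)
qed

text \<open>In the middle no shrinking occurs: by \<open>local_kernel\<close>, a vector of sum 0
  over \<open>V\<close> already comes from a section over \<open>V\<close>. Surjectivity is
  genuinely local: near a point of the chart of \<sigma>, the section is placed in the single
  coordinate \<open>idx \<sigma>\<close>.\<close>

lemma short_exact_extension: "short_exact \<Sigma> F (ext_incl n) E (ext_sum n) G"
  unfolding short_exact_def
proof (intro allI impI conjI ballI)
  fix V s
  assume s: "s \<in> F V" "ext_incl n s = 0"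
  show "s = 0"
  proof
    fix i
    show "s i = 0 i"
      using s fun_cong[OF s(2), of i] unfolding direct_sum_def ext_incl_def
      by (cases "i \<in> {1..n}") auto
  qed
next
  fix V e assume V: "openin X V" and e: "e \<in> E V"
  show "ext_sum n e = 0 \<longleftrightarrow>
    (\<forall>x\<in>V. \<exists>W. openin X W \<and> x \<in> W \<and> W \<subseteq> V \<and> (\<exists>s\<in>F W. ext_incl n s = e))" (is "_ \<longleftrightarrow> ?R")
  proof
    assume sum: "ext_sum n e = 0"
    define s where "s = (\<lambda>i. if i \<in> {1..n} then e i else 0)"
    have "e i \<in> div_sheaf \<Sigma> hP V" if i: "i \<le> n" for i
    proof -
      have "e i / hP \<sigma> \<in> x" if "\<sigma> \<in> \<Sigma>" "x \<in> V \<inter> chart \<sigma>" for \<sigma> x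
        using that e i unfolding direct_sum_def div_sheaf_def
        by (intro local_kernel[OF _ _ _ sum]) auto
      then show ?thesis using e i unfolding direct_sum_def div_sheaf_def by auto
    qed
    then have "s \<in> F V" unfolding direct_sum_def s_def by auto
    moreover have "ext_incl n s = e"
      using e sum by (intro ext_incl_eqI) (auto simp: s_def direct_sum_def)
    ultimately show ?R using V by blast
  next
    assume R: ?R
    show "ext_sum n e = 0"
    \<comment> \<open>Over the empty set the local condition is void, but there every section is
      0.\<close>
    proof (cases "V = {}")
      case True
      then have "e i = 0" for i using e unfolding direct_sum_def div_sheaf_def
        by (cases "i \<in> {0..n}") auto
      then show ?thesis by (simp add: ext_sum_def)
    next
      case False
      then show ?thesis using R ext_sum_ext_incl by blast
    qed
  qed
next
  fix V g x assume V: "openin X V" and g: "g \<in> G V" and x: "x \<in> V"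
  obtain \<sigma> where \<sigma>: "\<sigma> \<in> \<Sigma>" "x \<in> chart \<sigma>" using openin_chartE V x by blast
  note eq = eqD[OF idx[OF \<sigma>(1)]]
  define W where "W = V \<inter> {y \<in> topspace X. \<forall>\<tau>\<in>\<Sigma>. y \<in> chart \<tau> \<longrightarrow> g / hD (idx \<sigma>) \<tau> \<in> y}"
  define e where "e = (\<lambda>i. if i = idx \<sigma> then g else 0)"
  have W: "openin X W" "W \<subseteq> V" unfolding W_def using V openin_local_sections[OF eq] by auto
  have "(g / hM \<sigma>) * (hM \<sigma> / hD (idx \<sigma>) \<sigma>) \<in> x"
    using local_ring_mult[OF \<sigma>(2) _ M_le_idx[OF \<sigma>]] g \<sigma> x unfolding div_sheaf_def by blast
  then have "g / hD (idx \<sigma>) \<sigma> \<in> x" using local_equations_nonzero[OF eqM \<sigma>(1)] by simp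
  then have "g / hD (idx \<sigma>) \<tau> \<in> x" if "\<tau> \<in> \<Sigma>" "x \<in> chart \<tau>" for \<tau>
    using local_equations_change[OF eq \<sigma> that] by blast
  then have xW: "x \<in> W" unfolding W_def using x openin_subset[OF V] by blast
  then have "g \<in> div_sheaf \<Sigma> (hD (idx \<sigma>)) W" unfolding div_sheaf_def W_def by blast
  then have "e \<in> E W"
    unfolding direct_sum_def e_def using div_sheaf_zero idx[OF \<sigma>(1)] by auto
  moreover have "ext_sum n e = g"
    unfolding ext_sum_def e_def using idx[OF \<sigma>(1)] by simp
  ultimately show "\<exists>W. openin X W \<and> x \<in> W \<and> W \<subseteq> V \<and> (\<exists>e\<in>E W. ext_sum n e = g)"
    using W xW by blast
qed

section \<open>Constant and unit sections of the twisted sheaves\<close>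

lemma unit_on_chart:
  assumes \<sigma>: "\<sigma> \<in> \<Sigma>" "chart \<sigma> \<noteq> ({} :: 'd ratfun set set)"
  shows "1 \<in> div_sheaf \<Sigma> (\<lambda>\<tau>. hD (idx \<sigma>) \<tau> / hM \<tau>) (chart \<sigma>)"
proof (rule div_sheafI[OF eqEM[OF idx[OF \<sigma>(1)]] \<sigma>(2)])
  fix x :: "'d ratfun set" assume "x \<in> chart \<sigma>"
  then show "\<exists>\<sigma>'\<in>\<Sigma>. x \<in> chart \<sigma>' \<and> 1 / (hD (idx \<sigma>) \<sigma>' / hM \<sigma>') \<in> x"
    using \<sigma>(1) M_le_idx by (intro bexI[of _ \<sigma>]) simp_all
qed

text \<open>With \<open>b = idx \<tau>\<close>, O(\<Delta>^-) agrees with O(\<nabla>_b) through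
  \<tau>, and O(\<nabla>_b) agrees with O(\<Delta>^+) through \<sigma>, whose index differs. So on
  the overlap the difference sheaf is the structure sheaf.\<close>

lemma const_on_overlap:
  assumes \<sigma>: "\<sigma> \<in> \<Sigma>" and \<tau>: "\<tau> \<in> \<Sigma>" and ne: "chart \<sigma> \<inter> chart \<tau> \<noteq> ({} :: 'd ratfun set set)"
    and idx_ne: "idx \<sigma> \<noteq> idx \<tau>"
  shows "const_fun c \<in> L (chart \<sigma> \<inter> chart \<tau>)"
proof (rule div_sheafI[OF eqL ne])
  fix x :: "'d ratfun set" assume x: "x \<in> chart \<sigma> \<inter> chart \<tau>"
  let ?b = "idx \<tau>"
  have b: "?b \<le> n" using idx \<tau> by blast
  have "1 / (hD ?b \<tau> / hM \<tau>) \<in> x" using M_le_idx[OF \<tau>] x by simp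
  then have "1 / (hD ?b \<sigma> / hM \<sigma>) \<in> x"
    using local_equations_change[OF eqEM[OF b] \<tau> _ \<sigma>] x by blast
  then have "hM \<sigma> / hD ?b \<sigma> \<in> x" by simp
  moreover have "hD ?b \<sigma> / hP \<sigma> \<in> x" using D_le_P[OF b _ \<sigma>] idx_ne x by auto
  ultimately have "(hM \<sigma> / hD ?b \<sigma>) * (hD ?b \<sigma> / hP \<sigma>) \<in> x" using local_ring_mult x by blast
  then have "hM \<sigma> / hP \<sigma> \<in> x" using local_equations_nonzero[OF eqD[OF b] \<sigma>] by simp
  then have "const_fun c * (hM \<sigma> / hP \<sigma>) \<in> x" using local_ring_mult local_ring_const x by blast
  then show "\<exists>\<rho>\<in>\<Sigma>. x \<in> chart \<rho> \<and> const_fun c / (hP \<rho> / hM \<rho>) \<in> x"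
    using \<sigma> x by (intro bexI[of _ \<sigma>]) simp_all
qed

text \<open>This covers the charts with empty S(\<sigma>); it is the reason why the constants there
  may be chosen freely.\<close>

lemma const_on_trivial_chart:
  assumes \<sigma>: "\<sigma> \<in> \<Sigma>" "chart \<sigma> \<noteq> ({} :: 'd ratfun set set)"
    and triv: "\<And>x. x \<in> chart \<sigma> \<Longrightarrow> hM \<sigma> / hP \<sigma> \<in> x"
  shows "const_fun c \<in> L (chart \<sigma>)"
proof (rule div_sheafI[OF eqL \<sigma>(2)])
  fix x :: "'d ratfun set" assume x: "x \<in> chart \<sigma>"
  have "const_fun c * (hM \<sigma> / hP \<sigma>) \<in> x"
    using local_ring_mult[OF x] local_ring_const[OF x] triv[OF x] by blast
  then show "\<exists>\<rho>\<in>\<Sigma>. x \<in> chart \<rho> \<and> const_fun c / (hP \<rho> / hM \<rho>) \<in> x"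
    using \<sigma> x by (intro bexI[of _ \<sigma>]) simp_all
qed

text \<open>The twist is undone at each point by multiplying with the local equation
  \<open>hM \<tau>\<close>, which leaves the sum 0 and reduces the claim to
  \<open>local_kernel\<close>.\<close>

lemma kernel_section:
  assumes e: "e \<in> EM V" and sum: "ext_sum n e = 0" and i: "i \<le> n"
  shows "e i \<in> L V"
proof -
  have "e i / (hP \<tau> / hM \<tau>) \<in> x" if \<tau>: "\<tau> \<in> \<Sigma>" "x \<in> V \<inter> chart \<tau>" for \<tau> x
  proof -
    have "(e i * hM \<tau>) / hP \<tau> \<in> x"
    proof (rule local_kernel[of \<tau> x "\<lambda>i. e i * hM \<tau>"])
      show "ext_sum n (\<lambda>i. e i * hM \<tau>) = 0"
        using sum unfolding ext_sum_def by (simp flip: sum_distrib_right)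
      show "e i * hM \<tau> / hD i \<tau> \<in> x" if "i \<le> n" for i
      proof -
        have "e i / (hD i \<tau> / hM \<tau>) \<in> x"
          using e that \<tau> unfolding direct_sum_def div_sheaf_def by auto
        then show ?thesis by simp
      qed
    qed (use \<tau> i in auto)
    then show ?thesis by simp
  qed
  then show ?thesis using e i unfolding direct_sum_def div_sheaf_def by auto
qed

section \<open>Cech classes for a covering by charts that share the generic point\<close>

context
  fixes k :: nat and \<sigma> :: "nat \<Rightarrow> 'd rvec set"
  assumes \<sigma>: "\<And>i. i \<in> {1..k} \<Longrightarrow> \<sigma> i \<in> \<Sigma>"
    and generic: "\<And>i. i \<in> {1..k} \<Longrightarrow> (UNIV :: 'd ratfun set) \<in> chart (\<sigma> i)"
begin

abbreviation U :: "nat \<Rightarrow> 'd ratfun set set" where "U i \<equiv> chart (\<sigma> i)"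

text \<open>In the application the constants are the values of the indicator function of
  \<open>C a\<close> on each nonempty S(\<sigma>_i). They are also the entries \<open>a\<close> of
  the lifts \<open>unit_lift\<close>, so this cocycle links the two sides of the theorem.\<close>

definition unit_cocycle :: "nat \<Rightarrow> nat \<Rightarrow> nat \<Rightarrow> 'd ratfun" where
  "unit_cocycle a = cech_diff k (\<lambda>i. const_fun (if idx (\<sigma> i) = a then 1 else 0))"

definition unit_lift :: "nat \<Rightarrow> nat \<Rightarrow> 'd ratfun" where
  "unit_lift i = (\<lambda>b. if b = idx (\<sigma> i) then 1 else 0)"

lemma U_nonempty: "i \<in> {1..k} \<Longrightarrow> U i \<noteq> {}"
  using generic by blast

text \<open>Needed because a section over the empty set must be 0: both the presence of constants on
  overlaps and restriction to overlaps depend on it.\<close>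

lemma U_Int_nonempty: "i \<in> {1..k} \<Longrightarrow> j \<in> {1..k} \<Longrightarrow> U i \<inter> U j \<noteq> {}"
  using generic by blast

lemma unit_lift_section: "i \<in> {1..k} \<Longrightarrow> unit_lift i \<in> EM (U i)"
  unfolding direct_sum_def unit_lift_def
  using unit_on_chart[OF \<sigma> U_nonempty] idx[OF \<sigma>] div_sheaf_zero by auto

lemma ext_sum_unit_lift: "i \<in> {1..k} \<Longrightarrow> ext_sum n (unit_lift i) = 1"
  unfolding ext_sum_def unit_lift_def using idx[OF \<sigma>] by simp

lemma unit_cocycle_in_Z1: "unit_cocycle a \<in> cech_Z1 k U L"
  unfolding unit_cocycle_def
proof (rule cech_diff_in_Z1)
  fix i j assume ij: "1 \<le> i" "i < j" "j \<le> k"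
  let ?c = "\<lambda>i. if idx (\<sigma> i) = a then 1 else 0 :: complex"
  have "const_fun (?c j - ?c i) \<in> L (U i \<inter> U j)"
  proof (cases "idx (\<sigma> i) = idx (\<sigma> j)")
    case True
    then show ?thesis using div_sheaf_zero by simp
  next
    case False
    then show ?thesis using ij by (intro const_on_overlap \<sigma> U_Int_nonempty) auto
  qed
  then show "const_fun (?c j) - const_fun (?c i) \<in> L (U i \<inter> U j)"
    by (simp only: const_fun_diff)
qed

lemma unit_cocycle_degree: "unit_cocycle a i j \<in> laurent_span {0}"
proof -
  have "const_fun c - const_fun d \<in> laurent_span {0}" for c d
    by (simp add: const_fun_in_laurent_span flip: const_fun_diff)
  then show ?thesis
    unfolding unit_cocycle_def cech_diff_def
    by (cases "1 \<le> i \<and> i < j \<and> j \<le> k"; simp only: simp_thms if_True if_False laurent_span_zero)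
qed

lemma unit_cocycle_eq:
  "1 \<le> i \<Longrightarrow> i < j \<Longrightarrow> j \<le> k \<Longrightarrow> unit_cocycle a i j = unit_lift j a - unit_lift i a"
  unfolding unit_cocycle_def unit_lift_def cech_diff_def by auto

text \<open>Both sides are sets, so two inclusions are due. Another choice of lifts changes entry
  \<open>a\<close> by the coboundary of a cochain in the kernel. Conversely, any coboundary in entry
  \<open>a\<close> is produced by moving the unit lifts within the kernel.\<close>

lemma connecting_extension:
  assumes a: "a \<in> {1..n}"
  shows "(\<lambda>z i j. z i j a) ` connecting k U (direct_sum {1..n} (\<lambda>_. L)) (ext_incl n) EM (ext_sum n) 1
    = cech_rel k U L `` {unit_cocycle a}"
proof (intro Set.set_eqI iffI)
  fix w
  assume "w \<in> (\<lambda>z i j. z i j a) `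
    connecting k U (direct_sum {1..n} (\<lambda>_. L)) (ext_incl n) EM (ext_sum n) 1"
  then obtain z where w: "w = (\<lambda>i j. z i j a)"
    and zc: "z \<in> connecting k U (direct_sum {1..n} (\<lambda>_. L)) (ext_incl n) EM (ext_sum n) 1"
    by (rule imageE)
  from zc obtain e where z: "z \<in> cech_Z1 k U (direct_sum {1..n} (\<lambda>_. L))"
    and lift: "\<forall>i\<in>{1..k}. e i \<in> EM (U i) \<and> ext_sum n (e i) = 1"
    and ze: "\<forall>i j. 1 \<le> i \<and> i < j \<and> j \<le> k \<longrightarrow> ext_incl n (z i j) = e j - e i"
    by (rule connectingE)
  note e = lift[rule_format]
  \<comment> \<open>Two lifts of the section 1 differ by a vector of sum 0, whose entries are
    sections of the difference sheaf.\<close>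
  have s: "(e i - unit_lift i) a \<in> L (U i)" if i: "i \<in> {1..k}" for i
  proof (rule kernel_section)
    show "e i - unit_lift i \<in> EM (U i)"
      using e[OF i] unit_lift_section[OF i] unfolding direct_sum_def by (auto intro: div_sheaf_diff)
    show "ext_sum n (e i - unit_lift i) = 0"
      using e[OF i] ext_sum_unit_lift[OF i] by (simp add: ext_sum_def sum_subtractf)
  qed (use a in simp)
  have "w \<in> cech_Z1 k U L"
  proof (rule cech_Z1I)
    show "w i j \<in> L (U i \<inter> U j)" if "1 \<le> i" "i < j" "j \<le> k" for i j
      using cech_Z1_section[OF z that] a by (simp add: w direct_sum_def)
    show "w i j = 0" if "\<not> (1 \<le> i \<and> i < j \<and> j \<le> k)" for i j
      using cech_Z1_outside[OF z that] by (simp add: w)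
    show "w j l - w i l + w i j = 0" if "1 \<le> i" "i < j" "j < l" "l \<le> k" for i j l
      using fun_cong[OF cech_Z1_cocycle[OF z that], of a] by (simp add: w)
  qed
  moreover have "w - unit_cocycle a = cech_diff k (\<lambda>i. (e i - unit_lift i) a)"
  proof (intro ext)
    fix i j
    show "(w - unit_cocycle a) i j = cech_diff k (\<lambda>i. (e i - unit_lift i) a) i j"
    proof (cases "1 \<le> i \<and> i < j \<and> j \<le> k")
      case True
      then have "ext_incl n (z i j) a = (e j - e i) a" using ze by simp
      then have "z i j a = e j a - e i a" using a by (simp add: ext_incl_def)
      then show ?thesis using True unit_cocycle_eq[of i j a] by (simp add: w cech_diff_def)
    next
      case False
      then show ?thesis using cech_Z1_outside[OF z False] by (auto simp: w cech_diff_def unit_cocycle_def)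
    qed
  qed
  ultimately show "w \<in> cech_rel k U L `` {unit_cocycle a}"
    using s by (intro cech_relI unit_cocycle_in_Z1)
next
  fix w assume "w \<in> cech_rel k U L `` {unit_cocycle a}"
  then obtain s where w: "w \<in> cech_Z1 k U L" and sec: "\<forall>i\<in>{1..k}. s i \<in> L (U i)"
    and ws: "w - unit_cocycle a = cech_diff k s"
    by (rule cech_relE)
  note s = sec[rule_format]
  \<comment> \<open>Only entry \<open>a\<close> is prescribed by \<open>w\<close>; the other entries
    of the tuple are filled with the standard cocycles, which the unit lifts produce.\<close>
  define y where "y = (\<lambda>b. if b = a then w else unit_cocycle b)"
  have y: "y b \<in> cech_Z1 k U L" for b using w unit_cocycle_in_Z1 by (simp add: y_def)
  define z where "z = (\<lambda>i j b. if b \<in> {1..n} then y b i j else 0)"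
  \<comment> \<open>The correction adds \<open>s i\<close> in entry \<open>a\<close> and
    \<open>- s i\<close> in entry 0. The sum stays 1, and the difference of lifts in entry
    \<open>a\<close> grows by exactly \<open>s j - s i\<close>.\<close>
  define e where "e = (\<lambda>i. unit_lift i + ext_incl n (\<lambda>b. if b = a then s i else 0))"
  have z_Z1: "z \<in> cech_Z1 k U (direct_sum {1..n} (\<lambda>_. L))"
  proof (rule cech_Z1I)
    show "z i j \<in> direct_sum {1..n} (\<lambda>_. L) (U i \<inter> U j)" if "1 \<le> i" "i < j" "j \<le> k" for i j
      using cech_Z1_section[OF y that] by (simp add: z_def direct_sum_def)
    show "z i j = 0" if "\<not> (1 \<le> i \<and> i < j \<and> j \<le> k)" for i j
      using cech_Z1_outside[OF y that] by (auto simp: z_def fun_eq_iff)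
    show "z j l - z i l + z i j = 0" if "1 \<le> i" "i < j" "j < l" "l \<le> k" for i j l
      using cech_Z1_cocycle[OF y that] by (auto simp: z_def fun_eq_iff)
  qed
  have e_sec: "e i \<in> EM (U i) \<and> ext_sum n (e i) = 1" if i: "i \<in> {1..k}" for i
  proof
    let ?t = "\<lambda>b. if b = a then s i else 0"
    have "?t \<in> direct_sum {1..n} (\<lambda>_. L) (U i)"
      using s[OF i] a div_sheaf_zero by (auto simp: direct_sum_def)
    moreover have "L (U i) \<subseteq> div_sheaf \<Sigma> (\<lambda>\<tau>. hD b \<tau> / hM \<tau>) (U i)" if "b \<le> n" for b
      using P_le_D[OF that] local_equations_nonzero[OF eqM]
      by (intro div_sheaf_mono[OF eqL]) simp
    ultimately have "ext_incl n ?t \<in> EM (U i)" by (rule ext_incl_div_sheaf)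
    then show "e i \<in> EM (U i)"
      using unit_lift_section[OF i] unfolding e_def direct_sum_def by (auto intro: div_sheaf_add)
    have "ext_sum n (e i) = ext_sum n (unit_lift i) + ext_sum n (ext_incl n ?t)"
      unfolding e_def by (simp add: ext_sum_def sum.distrib)
    then show "ext_sum n (e i) = 1" using ext_sum_unit_lift[OF i] ext_sum_ext_incl[of n ?t] by simp
  qed
  have "ext_incl n (z i j) = e j - e i" if ij: "1 \<le> i" "i < j" "j \<le> k" for i j
  proof (rule ext_incl_eqI)
    show "ext_sum n (e j - e i) = 0"
      using e_sec[of i] e_sec[of j] ij by (simp add: ext_sum_def sum_subtractf)
    show "(e j - e i) b = 0" if "b > n" for b
      using e_sec[of i] e_sec[of j] ij that by (simp add: direct_sum_def)
    show "z i j b = (e j - e i) b" if b: "b \<in> {1..n}" for b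
    proof -
      have "w i j - unit_cocycle a i j = s j - s i"
        using fun_cong[OF fun_cong[OF ws, of i], of j] ij by (simp add: cech_diff_def)
      then show ?thesis
        using b unit_cocycle_eq[OF ij] by (auto simp: z_def y_def e_def ext_incl_def algebra_simps)
    qed
  qed
  then have "z \<in> connecting k U (direct_sum {1..n} (\<lambda>_. L)) (ext_incl n) EM (ext_sum n) 1"
    unfolding connecting_def mem_Collect_eq by (intro conjI exI[of _ e] ballI allI impI z_Z1 e_sec) auto
  moreover have "w = (\<lambda>i j. z i j a)" using a by (simp add: z_def y_def)
  ultimately show "w \<in> (\<lambda>z i j. z i j a) `
    connecting k U (direct_sum {1..n} (\<lambda>_. L)) (ext_incl n) EM (ext_sum n) 1" by blast
qed

text \<open>The common shift \<open>c0\<close> cancels in differences. What remains of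
  \<open>c\<close> is supported on charts where the difference sheaf is trivial, hence is a
  0-cochain of sections, and the two cocycles differ by its coboundary.\<close>

lemma class_of_constants:
  assumes c: "\<And>i. i \<in> {1..k} \<Longrightarrow> c i = (if idx (\<sigma> i) = a then 1 else 0) + c0 \<or>
      (\<forall>x\<in>U i. hM (\<sigma> i) / hP (\<sigma> i) \<in> x)"
  shows "cech_rel k U L `` {cech_diff k (\<lambda>i. const_fun (c i))} = cech_rel k U L `` {unit_cocycle a}"
proof -
  define s where "s = (\<lambda>i. const_fun (c i - ((if idx (\<sigma> i) = a then 1 else 0) + c0)) :: 'd ratfun)"
  have s: "s i \<in> L (U i)" if i: "i \<in> {1..k}" for i
  proof (cases "c i = (if idx (\<sigma> i) = a then 1 else 0) + c0")
    case True
    then show ?thesis using div_sheaf_zero by (simp add: s_def)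
  next
    case False
    then show ?thesis
      unfolding s_def using c[OF i] by (intro const_on_trivial_chart \<sigma> U_nonempty i) auto
  qed
  have s_eq: "s = (\<lambda>i. const_fun (c i) - (const_fun (if idx (\<sigma> i) = a then 1 else 0) + const_fun c0))"
    by (simp only: s_def const_fun_diff const_fun_add)
  have diff: "cech_diff k (\<lambda>i. const_fun (c i)) = unit_cocycle a + cech_diff k s"
    unfolding unit_cocycle_def s_eq cech_diff_def by (auto simp: fun_eq_iff)
  have "cech_diff k s \<in> cech_Z1 k U L"
  proof (rule cech_diff_in_Z1)
    fix i j assume "1 \<le> i" "i < j" "j \<le> k"
    then have ij: "i \<in> {1..k}" "j \<in> {1..k}" by auto
    show "s j - s i \<in> L (U i \<inter> U j)"
      by (intro div_sheaf_diff div_sheaf_restrict[OF s[OF ij(1)]] div_sheaf_restrict[OF s[OF ij(2)]]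
          U_Int_nonempty ij Int_lower1 Int_lower2)
  qed
  then have "cech_diff k (\<lambda>i. const_fun (c i)) \<in> cech_Z1 k U L"
    unfolding diff by (intro cech_Z1_add unit_cocycle_in_Z1 div_sheaf_add)
  then have "cech_rel k U L `` {unit_cocycle a} =
      cech_rel k U L `` {cech_diff k (\<lambda>i. const_fun (c i))}"
    by (rule cech_rel_class_eq[OF unit_cocycle_in_Z1, of _ s])
      (simp_all add: s diff div_sheaf_add div_sheaf_uminus)
  then show ?thesis ..
qed

end

end

section \<open>The theorem\<close>

theorem theorem16:
  fixes \<Delta> \<Delta>p \<Delta>m :: "'d::{finite,linorder} rvec set"
    and C D \<sigma> :: "nat \<Rightarrow> 'd rvec set"
    and n k :: nat
  assumes "lattice_polyhedron \<Delta>" and "aff_dim \<Delta> = int CARD('d)"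
    and fan: "\<Sigma> = normal_fan \<Delta>"
    and cones: "bij_betw \<sigma> {1..k} (maximal_cones \<Sigma>)"
    and "lattice_polyhedron \<Delta>p" and "\<Delta>p \<in> Pol_plus \<Sigma>"
    and "lattice_polyhedron \<Delta>m" and "\<Delta>m \<in> Pol_plus \<Sigma>"
    and "\<Delta>p \<subseteq> \<Delta>m"
    and "n \<ge> 2"
    and "bij_betw C {0..n} (components (\<Delta>m - \<Delta>p))"
    and "\<And>i. i \<le> n \<Longrightarrow> D i = C i \<union> \<Delta>p"
    and "\<And>i. i \<le> n \<Longrightarrow> D i \<in> Pol_plus \<Sigma>"
    and F: "F = direct_sum {1..n} (\<lambda>_. line_sheaf \<Sigma> \<Delta>p)"
    and E: "E = direct_sum {0..n} (\<lambda>i. line_sheaf \<Sigma> (D i))"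
    and G: "G = line_sheaf \<Sigma> \<Delta>m"
  shows "sheaf_hom \<Sigma> vscale vscale F E (ext_incl n) \<and>
         sheaf_hom \<Sigma> vscale (*) E G (ext_sum n) \<and>
         (\<forall>m :: 'd \<Rightarrow>\<^sub>0 int. \<forall>s\<in>homogeneous m. ext_incl n s \<in> homogeneous m) \<and>
         (\<forall>m :: 'd \<Rightarrow>\<^sub>0 int. \<forall>e\<in>homogeneous m. ext_sum n e \<in> laurent_span {m}) \<and>
         short_exact \<Sigma> F (ext_incl n) E (ext_sum n) G \<and>
         (\<forall>a\<in>{1..n}. const_rel (\<Delta>m - \<Delta>p) `` {indicator (C a)} \<in> reduced_H0 (\<Delta>m - \<Delta>p)) \<and>
         ext_class \<Sigma> k \<sigma> n \<Delta>p \<Delta>m (ext_incl n) E (ext_sum n) \<in>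
           {1..n} \<rightarrow>\<^sub>E cech_H1_deg 0 k (\<lambda>i. chart (\<sigma> i)) (difference_sheaf \<Sigma> \<Delta>p \<Delta>m) \<and>
         ext_class \<Sigma> k \<sigma> n \<Delta>p \<Delta>m (ext_incl n) E (ext_sum n) =
           (\<lambda>a\<in>{1..n}. H0_to_H1 \<Sigma> k \<sigma> \<Delta>p \<Delta>m
              (const_rel (\<Delta>m - \<Delta>p) `` {indicator (C a)}))"
proof -

  \<comment> \<open>The components of the difference\<close>
  let ?Z = "\<Delta>m - \<Delta>p"
  note comps = \<open>bij_betw C {0..n} (components ?Z)\<close>
  note D_eq = \<open>\<And>i. i \<le> n \<Longrightarrow> D i = C i \<union> \<Delta>p\<close>
  have comp: "C i \<in> components ?Z" if "i \<le> n" for i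
    using comps that unfolding bij_betw_def by auto
  have comp_cover: "\<exists>i\<le>n. z \<in> C i" if "z \<in> ?Z" for z
  proof -
    have "z \<in> \<Union>(C ` {0..n})"
      using comps Union_components[of ?Z] that unfolding bij_betw_def by simp
    then show ?thesis by auto
  qed
  have comp_inj: "i = j" if "i \<le> n" "j \<le> n" "C i = C j" for i j
    using comps that unfolding bij_betw_def inj_on_def by auto
  have comp_eq: "i = j" if "i \<le> n" "j \<le> n" "z \<in> C i" "z \<in> C j" for i j z
    using comp_inj components_eq[OF comp comp] that by blast
  have fin: "finite (components ?Z)" using comps bij_betw_finite by blast
  have ne: "\<Delta>p \<noteq> {}" "\<Delta>m \<noteq> {}"
    using \<open>lattice_polyhedron \<Delta>p\<close> \<open>lattice_polyhedron \<Delta>m\<close>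
    by (auto simp: lattice_polyhedron_def extreme_point_of_def)

  \<comment> \<open>Minimal vertices and the local equations they give\<close>
  define vtx where "vtx = (\<lambda>P (\<tau> :: 'd rvec set). SOME m. real_pt m \<in> P \<and> (\<forall>w\<in>P. w - real_pt m \<in> dual_cone \<tau>))"
  have vtx: "real_pt (vtx P \<tau>) \<in> P" "w \<in> P \<Longrightarrow> w - real_pt (vtx P \<tau>) \<in> dual_cone \<tau>"
    if "P \<in> Pol_plus \<Sigma>" "P \<noteq> {}" "\<tau> \<in> \<Sigma>" for P \<tau> w
    using someI_ex[OF Pol_plus_vertex[OF fan that]] unfolding vtx_def by blast+
  note vp = vtx[OF \<open>\<Delta>p \<in> Pol_plus \<Sigma>\<close> ne(1)] and vm = vtx[OF \<open>\<Delta>m \<in> Pol_plus \<Sigma>\<close> ne(2)]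
  have vD: "real_pt (vtx (D i) \<tau>) \<in> D i" "w \<in> D i \<Longrightarrow> w - real_pt (vtx (D i) \<tau>) \<in> dual_cone \<tau>"
    if "i \<le> n" "\<tau> \<in> \<Sigma>" for i \<tau> w
    using vtx[OF \<open>\<And>i. i \<le> n \<Longrightarrow> D i \<in> Pol_plus \<Sigma>\<close>[OF that(1)] _ that(2)] D_eq[OF that(1)] ne(1)
    by blast+
  have D_sub: "\<Delta>p \<subseteq> D i" "D i \<subseteq> \<Delta>m" if "i \<le> n" for i
    using D_eq[OF that] in_components_subset[OF comp[OF that]] \<open>\<Delta>p \<subseteq> \<Delta>m\<close> by auto
  define hP hM hD where "hP = (\<lambda>\<tau>. monom_fun (vtx \<Delta>p \<tau>))" and "hM = (\<lambda>\<tau>. monom_fun (vtx \<Delta>m \<tau>))"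
    and "hD = (\<lambda>i \<tau>. monom_fun (vtx (D i) \<tau>))"
  have sheaf: "line_sheaf \<Sigma> \<Delta>p = div_sheaf \<Sigma> hP" "line_sheaf \<Sigma> \<Delta>m = div_sheaf \<Sigma> hM"
    "i \<le> n \<Longrightarrow> line_sheaf \<Sigma> (D i) = div_sheaf \<Sigma> (hD i)" for i
  proof -
    show "line_sheaf \<Sigma> \<Delta>p = div_sheaf \<Sigma> hP"
      unfolding hP_def by (rule line_sheaf_eq_div_sheaf) (use vp in blast)+
    show "line_sheaf \<Sigma> \<Delta>m = div_sheaf \<Sigma> hM"
      unfolding hM_def by (rule line_sheaf_eq_div_sheaf) (use vm in blast)+
    show "line_sheaf \<Sigma> (D i) = div_sheaf \<Sigma> (hD i)" if "i \<le> n"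
      unfolding hD_def by (rule line_sheaf_eq_div_sheaf) (use vD[OF that] in blast)+
  qed

  \<comment> \<open>The local differences and the component containing each of them\<close>
  let ?S = "\<lambda>\<tau>. \<Delta>m - (\<Delta>p + dual_cone \<tau>)"
  have "convex \<Delta>m"
    using \<open>lattice_polyhedron \<Delta>m\<close> polyhedron_imp_convex unfolding lattice_polyhedron_def by blast
  then have S: "real_pt (vtx \<Delta>m \<tau>) \<in> ?S \<tau>" "connected (?S \<tau>)" if "\<tau> \<in> \<Sigma>" "?S \<tau> \<noteq> {}" for \<tau>
    using connected_local_difference[of \<Delta>m "real_pt (vtx \<Delta>m \<tau>)" \<tau> \<Delta>p "real_pt (vtx \<Delta>p \<tau>)"]
      vp[OF that(1)] vm[OF that(1)] \<open>\<Delta>p \<subseteq> \<Delta>m\<close> that(2) by blast+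
  have "0 \<in> dual_cone \<tau>" for \<tau> :: "'d rvec set" by (rule dual_cone_zero)
  then have "\<Delta>p \<subseteq> \<Delta>p + dual_cone \<tau>" for \<tau> using set_zero_plus2[of "dual_cone \<tau>" \<Delta>p] by (simp add: add.commute)
  then have S_Z: "?S \<tau> \<subseteq> ?Z" for \<tau> by blast
  \<comment> \<open>Asking for membership in \<open>D a\<close> rather than \<open>C a\<close> also
    covers a vertex in \<open>\<Delta>p\<close>, for which every index qualifies; otherwise the
    index is unique.\<close>
  define idx where "idx = (\<lambda>\<tau>. SOME a. a \<le> n \<and> real_pt (vtx \<Delta>m \<tau>) \<in> D a)"
  have idx: "idx \<tau> \<le> n" "real_pt (vtx \<Delta>m \<tau>) \<in> D (idx \<tau>)" if "\<tau> \<in> \<Sigma>" for \<tau>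
  proof -
    have "\<exists>a\<le>n. real_pt (vtx \<Delta>m \<tau>) \<in> D a"
    proof (cases "real_pt (vtx \<Delta>m \<tau>) \<in> \<Delta>p")
      case True
      then show ?thesis using D_sub(1)[of 0] by blast
    next
      case False
      then show ?thesis using comp_cover vm(1)[OF that] D_eq by blast
    qed
    from someI_ex[OF this] show "idx \<tau> \<le> n" "real_pt (vtx \<Delta>m \<tau>) \<in> D (idx \<tau>)"
      unfolding idx_def by blast+
  qed
  have S_comp: "?S \<tau> \<subseteq> C (idx \<tau>)" if \<tau>: "\<tau> \<in> \<Sigma>" for \<tau>
  proof (cases "?S \<tau> = {}")
    case False
    then have u: "real_pt (vtx \<Delta>m \<tau>) \<in> ?S \<tau>" using S \<tau> by blast
    \<comment> \<open>The vertex avoids \<open>\<Delta>p\<close>, so its membership in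
      \<open>D (idx \<tau>)\<close> comes from the component.\<close>
    then have "real_pt (vtx \<Delta>m \<tau>) \<in> C (idx \<tau>)" using idx[OF \<tau>] D_eq S_Z by blast
    then show ?thesis
      using components_maximal[OF comp[OF idx(1)[OF \<tau>]] S(2)[OF \<tau> False] S_Z] u by blast
  qed blast
  have trivial: "real_pt (vtx \<Delta>m \<tau>) - real_pt (vtx \<Delta>p \<tau>) \<in> dual_cone \<tau>"
    if "\<tau> \<in> \<Sigma>" "?S \<tau> = {}" for \<tau>
    using plus_dual_cone_iff[OF vp[OF that(1)]] vm(1)[OF that(1)] that(2) by blast

  \<comment> \<open>Comparison of the bundles on each chart\<close>
  have eqs: "local_equations \<Sigma> hP" "local_equations \<Sigma> hM" "\<And>i. i \<le> n \<Longrightarrow> local_equations \<Sigma> (hD i)"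
  proof -
    show "local_equations \<Sigma> hP" unfolding hP_def by (rule local_equations_monom[where P = \<Delta>p]) (use vp in blast)+
    show "local_equations \<Sigma> hM" unfolding hM_def by (rule local_equations_monom[where P = \<Delta>m]) (use vm in blast)+
    show "local_equations \<Sigma> (hD i)" if "i \<le> n" for i
      unfolding hD_def by (rule local_equations_monom[where P = "D i"]) (use vD[OF that] in blast)+
  qed
  have P_le_D: "hP \<tau> / hD i \<tau> \<in> x" if "i \<le> n" "\<tau> \<in> \<Sigma>" "x \<in> chart \<tau>" for i \<tau> and x :: "'d ratfun set"
    unfolding hP_def hD_def using vD(2)[OF that(1,2)] vp(1)[OF that(2)] D_sub(1)[OF that(1)]
    by (intro monom_quotient_in_local_ring[OF that(3)]) blast
  have D_le_M: "hD i \<tau> / hM \<tau> \<in> x" if "i \<le> n" "\<tau> \<in> \<Sigma>" "x \<in> chart \<tau>" for i \<tau> and x :: "'d ratfun set"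
    unfolding hM_def hD_def using vm(2)[OF that(2)] vD(1)[OF that(1,2)] D_sub(2)[OF that(1)]
    by (intro monom_quotient_in_local_ring[OF that(3)]) blast
  \<comment> \<open>The minimal vertex of \<open>\<Delta>m\<close> was chosen to lie in
    \<open>D (idx \<tau>)\<close>, so it is in the cone at the minimal vertex of that
    polyhedron.\<close>
  have M_le_idx: "hM \<tau> / hD (idx \<tau>) \<tau> \<in> x" if "\<tau> \<in> \<Sigma>" "x \<in> chart \<tau>" for \<tau> and x :: "'d ratfun set"
    unfolding hM_def hD_def using idx[OF that(1)] vD(2)[OF idx(1)[OF that(1)] that(1)]
    by (intro monom_quotient_in_local_ring[OF that(2)]) blast
  \<comment> \<open>A vertex of \<open>D i\<close> outside the cone of \<open>\<Delta>p\<close>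
    would lie in \<open>?S \<tau>\<close>, hence in the component \<open>C (idx \<tau>)\<close>.
    Being outside \<open>\<Delta>p\<close> it would also lie in \<open>C i\<close>, against
    disjointness.\<close>
  have D_le_P: "hD i \<tau> / hP \<tau> \<in> x" if "i \<le> n" "i \<noteq> idx \<tau>" "\<tau> \<in> \<Sigma>" "x \<in> chart \<tau>"
    for i \<tau> and x :: "'d ratfun set"
    unfolding hP_def hD_def
  proof (rule monom_quotient_in_local_ring[OF that(4)], rule ccontr)
    let ?w = "real_pt (vtx (D i) \<tau>)"
    assume "?w - real_pt (vtx \<Delta>p \<tau>) \<notin> dual_cone \<tau>"
    then have "?w \<in> ?S \<tau>"
      using plus_dual_cone_iff[OF vp[OF that(3)]] vD(1)[OF that(1,3)] D_sub(2)[OF that(1)] by blast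
    then have "?w \<in> C (idx \<tau>)" "?w \<in> ?Z" using S_comp[OF that(3)] S_Z by blast+
    moreover from this have "?w \<in> C i" using vD(1)[OF that(1,3)] D_eq[OF that(1)] by blast
    ultimately show False using comp_eq that(1,2) idx(1)[OF that(3)] by blast
  qed
  interpret X: local_extension \<Sigma> hP hM hD n idx
    by (rule local_extension.intro) (fact eqs idx P_le_D D_le_M M_le_idx D_le_P)+

  \<comment> \<open>The covering, and the sheaves and cohomology of the statement in terms of local
    equations\<close>
  have F_eq: "F = X.F" unfolding F sheaf ..
  have E_eq: "E = X.E" unfolding E by (intro direct_sum_cong) (simp add: sheaf)
  have G_eq: "G = X.G" unfolding G sheaf ..

  have \<sigma>: "\<sigma> i \<in> \<Sigma>" if "i \<in> {1..k}" for i
    using cones that unfolding bij_betw_def maximal_cones_def by auto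
  have generic: "(UNIV :: 'd ratfun set) \<in> chart (\<sigma> i)" if "i \<in> {1..k}" for i
  proof (rule generic_point_in_chart, rule lattice_point_translates_into_dual_cone)
    show "interior (dual_cone (\<sigma> i)) \<noteq> {}"
      using interior_dual_cone_normal_fan \<sigma>[OF that] fan \<open>aff_dim \<Delta> = int CARD('d)\<close>
        \<open>lattice_polyhedron \<Delta>\<close> unfolding lattice_polyhedron_def by blast
  qed
  let ?U = "\<lambda>i. chart (\<sigma> i) :: 'd ratfun set set"
  let ?L = "difference_sheaf \<Sigma> \<Delta>p \<Delta>m"
  let ?z = "X.unit_cocycle k \<sigma>"
  have U_top: "?U i \<subseteq> topspace (toric_variety \<Sigma>)" if "i \<in> {1..k}" for i
    unfolding topspace_toric_variety using \<sigma>[OF that] by blast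
  have L: "?L (?U i \<inter> ?U j) = X.L (?U i \<inter> ?U j)" if "i \<in> {1..k}" "j \<in> {1..k}" for i j
    unfolding difference_sheaf_def sheaf using U_top that
    by (intro tensor_sheaf_line X.eqP X.eqM) blast
  have L_n: "direct_sum {1..n} (\<lambda>_. ?L) (?U i \<inter> ?U j) = direct_sum {1..n} (\<lambda>_. X.L) (?U i \<inter> ?U j)"
    if "i \<in> {1..k}" "j \<in> {1..k}" for i j
    using L[OF that] unfolding direct_sum_def by simp
  have E_M: "tensor_sheaf \<Sigma> vscale E (inv_sheaf \<Sigma> (line_sheaf \<Sigma> \<Delta>m)) (?U i) = X.EM (?U i)"
    if "i \<in> {1..k}" for i
    unfolding E_eq sheaf using U_top[OF that] by (intro tensor_sheaf_direct_sum X.eqM X.eqD) auto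
  have rel: "cech_rel k ?U ?L = cech_rel k ?U X.L" by (rule cech_rel_cong) (rule L)
  have Z1: "cech_Z1 k ?U ?L = cech_Z1 k ?U X.L" by (rule cech_Z1_cong) (rule L)
  have "connecting k ?U (direct_sum {1..n} (\<lambda>_. ?L)) (ext_incl n)
      (tensor_sheaf \<Sigma> vscale E (inv_sheaf \<Sigma> (line_sheaf \<Sigma> \<Delta>m))) (ext_sum n) 1
    = connecting k ?U (direct_sum {1..n} (\<lambda>_. X.L)) (ext_incl n) X.EM (ext_sum n) 1"
    by (rule connecting_cong) (rule L_n E_M; assumption)+
  then have ext_class_eq: "ext_class \<Sigma> k \<sigma> n \<Delta>p \<Delta>m (ext_incl n) E (ext_sum n)
    = (\<lambda>a\<in>{1..n}. cech_rel k ?U X.L `` {?z a})"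
    unfolding ext_class_def using X.connecting_extension[of k \<sigma>, OF \<sigma> generic]
    by (intro restrict_ext) simp

  have z_Z1: "?z a \<in> cech_Z1 k ?U X.L" for a
    by (rule X.unit_cocycle_in_Z1[of k \<sigma>]) (fact \<sigma> generic)+
  have z_degree: "?z a i j \<in> laurent_span {0}" for a i j
    by (rule X.unit_cocycle_degree[of k \<sigma>]) (fact \<sigma> generic)+

  \<comment> \<open>The image of the class of an indicator function\<close>
  have ind: "indicator (C a) \<in> loc_const ?Z" if "a \<le> n" for a
    using indicator_component_loc_const[OF fin comp[OF that]] .
  have H0: "H0_to_H1 \<Sigma> k \<sigma> \<Delta>p \<Delta>m (const_rel ?Z `` {indicator (C a)}) = cech_rel k ?U X.L `` {?z a}"
    if a: "a \<in> {1..n}" for a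
  proof -
    let ?c = "\<lambda>f. {c. \<forall>i\<in>{1..k}. \<forall>z\<in>?S (\<sigma> i). f z = c i}"
    let ?\<xi> = "const_rel ?Z `` {indicator (C a) :: 'd rvec \<Rightarrow> complex}"
    have a_le: "a \<le> n" using a by simp
    have ind_S: "indicator (C a) z = (if idx \<tau> = a then 1 else 0 :: complex)"
      if "\<tau> \<in> \<Sigma>" "z \<in> ?S \<tau>" for \<tau> z
    proof (cases "idx \<tau> = a")
      case True
      then have "z \<in> C a" using S_comp[OF that(1)] that(2) by blast
      then show ?thesis using True by simp
    next
      case False
      then have "z \<notin> C a" using comp_eq[OF a_le idx(1)[OF that(1)]] S_comp[OF that(1)] that(2) by blast
      then show ?thesis using False by simp
    qed
    have const: "cech_rel k ?U X.L `` {cech_diff k (\<lambda>i. const_fun (c i))} = cech_rel k ?U X.L `` {?z a}"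
      if f: "f \<in> ?\<xi>" and c: "c \<in> ?c f" for f c
    proof -
      obtain c0 where c0: "\<And>z. z \<in> ?Z \<Longrightarrow> f z = indicator (C a) z + c0"
        using f unfolding const_rel_def by blast
      have c_eq: "c i = (if idx (\<sigma> i) = a then 1 else 0) + c0 \<or> (\<forall>x\<in>?U i. hM (\<sigma> i) / hP (\<sigma> i) \<in> x)"
        if i: "i \<in> {1..k}" for i
      \<comment> \<open>An empty \<open>?S (\<sigma> i)\<close> leaves \<open>c i\<close>
        unconstrained, but then the chart is trivial; a nonempty one determines \<open>c i\<close>
        through any of its points.\<close>
      proof (cases "?S (\<sigma> i) = {}")
        case True
        then show ?thesis
          unfolding hM_def hP_def using trivial[OF \<sigma>[OF i]] monom_quotient_in_local_ring by blast
      next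
        case False
        then obtain z where z: "z \<in> ?S (\<sigma> i)" by blast
        have "c i = f z" using c i z by simp
        also have "\<dots> = indicator (C a) z + c0" using c0 S_Z z by blast
        finally show ?thesis using ind_S[OF \<sigma>[OF i] z] by simp
      qed
      show ?thesis by (rule X.class_of_constants[of k \<sigma>]) (fact \<sigma> generic c_eq)+
    qed
    \<comment> \<open>All members of the union in \<open>H0_to_H1\<close> are the same class. One
      admissible pair, the indicator with its own values, is still needed to make the union
      nonempty.\<close>
    have f0: "indicator (C a) \<in> ?\<xi>"
      unfolding const_rel_def using ind[OF a_le] by (auto intro: exI[of _ 0])
    let ?idx_a = "\<lambda>i. if idx (\<sigma> i) = a then 1 else 0 :: complex"
    have c0: "?idx_a \<in> ?c (indicator (C a))"
      unfolding mem_Collect_eq by (intro ballI ind_S \<sigma>)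
    have "(\<Union>f\<in>?\<xi>. \<Union>c\<in>?c f. cech_rel k ?U X.L `` {cech_diff k (\<lambda>i. const_fun (c i))})
        = cech_rel k ?U X.L `` {?z a}"
    proof (rule equalityI)
      show "(\<Union>f\<in>?\<xi>. \<Union>c\<in>?c f. cech_rel k ?U X.L `` {cech_diff k (\<lambda>i. const_fun (c i))})
          \<subseteq> cech_rel k ?U X.L `` {?z a}"
        by (intro UN_least equalityD1 const)
      show "cech_rel k ?U X.L `` {?z a}
          \<subseteq> (\<Union>f\<in>?\<xi>. \<Union>c\<in>?c f. cech_rel k ?U X.L `` {cech_diff k (\<lambda>i. const_fun (c i))})"
        unfolding const[OF f0 c0, symmetric] by (intro subsetI UN_I[OF f0] UN_I[OF c0])
    qed
    then show ?thesis unfolding H0_to_H1_def rel .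
  qed

  show ?thesis
  proof (intro conjI)
    show "sheaf_hom \<Sigma> vscale vscale F E (ext_incl n)"
      unfolding F_eq E_eq by (rule X.sheaf_hom_ext_incl)
    show "sheaf_hom \<Sigma> vscale (*) E G (ext_sum n)"
      unfolding G_eq E_eq by (rule X.sheaf_hom_ext_sum)
    show "\<forall>m :: 'd \<Rightarrow>\<^sub>0 int. \<forall>s\<in>homogeneous m. ext_incl n s \<in> homogeneous m"
      unfolding homogeneous_def ext_incl_def
      by (auto intro!: laurent_span_uminus laurent_span_sum laurent_span_zero)
    show "\<forall>m :: 'd \<Rightarrow>\<^sub>0 int. \<forall>e\<in>homogeneous m. ext_sum n e \<in> laurent_span {m}"
      unfolding homogeneous_def ext_sum_def by (auto intro!: laurent_span_sum)
    show "short_exact \<Sigma> F (ext_incl n) E (ext_sum n) G"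
      unfolding F_eq E_eq G_eq by (rule X.short_exact_extension)
    show "\<forall>a\<in>{1..n}. const_rel ?Z `` {indicator (C a)} \<in> reduced_H0 ?Z"
      unfolding reduced_H0_def using ind by (auto intro: quotientI)
    show "ext_class \<Sigma> k \<sigma> n \<Delta>p \<Delta>m (ext_incl n) E (ext_sum n) \<in>
        {1..n} \<rightarrow>\<^sub>E cech_H1_deg 0 k ?U ?L"
      unfolding ext_class_eq
    proof (rule restrict_PiE_iff[THEN iffD2], rule ballI)
      fix a
      show "cech_rel k ?U X.L `` {?z a} \<in> cech_H1_deg 0 k ?U ?L"
        unfolding cech_H1_deg_def rel Z1 mem_Collect_eq
        by (intro exI[of _ "?z a"] conjI refl allI z_Z1 z_degree)
    qed
    show "ext_class \<Sigma> k \<sigma> n \<Delta>p \<Delta>m (ext_incl n) E (ext_sum n) =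
        (\<lambda>a\<in>{1..n}. H0_to_H1 \<Sigma> k \<sigma> \<Delta>p \<Delta>m (const_rel ?Z `` {indicator (C a)}))"
      unfolding ext_class_eq by (intro restrict_ext) (simp only: H0)
  qed
qed

end
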